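(* Let $G=(\mathcal V,\mathcal E)$ be an undirected weighted graph with $n$ nodes and edge weights $b_e>0$, $e\in\mathcal E$, let $L\in\mathbb R^{n\times n}$ be its weighted Laplacian, and let $0=\lambda_1(L)<\lambda_2(L)\le\dots\le\lambda_n(L)$ be the eigenvalues of $L$. Let $m,d,\gamma>0$ and let $\mathcal G_{hom}(m,d)$ be the linear stochastic system with homogeneous inertia $M=m I$ and damping $D=d I$, namely $$\begin{bmatrix}\mathrm d\theta\\ \mathrm d\omega\end{bmatrix}=\begin{bmatrix}0& I\\ -\tfrac1m L& -\tfrac dm I\end{bmatrix}\begin{bmatrix}\theta\\ \omega\end{bmatrix}\mathrm dt+\begin{bmatrix}0\\ \tfrac1m\gamma^{1/2}L^{1/2}\end{bmatrix}\mathrm dW,\qquad y=\begin{bmatrix}L\theta\\ \omega\end{bmatrix},$$ where $\theta(t),\omega(t)\in\mathbb R^n$, $W$ is a standard $n$-dimensional Wiener process, and the initial state $(\theta_0,\omega_0)$ is normally distributed and independent of $W$. Then the squared $\mathcal H_2$ norm $\|\mathcal G_{hom}(m,d)\|_2^2=\lim_{t\to\infty}\mathbb E\{y(t)^\top y(t)\}$ is given by $$\|\mathcal G_{hom}(m,d)\|_2^2=\frac{\gamma}{2d}\sum_{i=2}^{n}\left(\lambda_i^2(L)+\frac{\lambda_i(L)}{m}\right).$$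
   Context: The weighted Laplacian is $L=\mathcal B\,\Gamma\,\mathcal B^\top$, where $\mathcal B\in\mathbb R^{n\times |\mathcal E|}$ is the oriented node-edge incidence matrix of $G$ and $\Gamma=\mathrm{diag}(b_e)_{e\in\mathcal E}$. $L^{1/2}$ denotes the symmetric positive semidefinite square root of $L$, and $I$ the identity matrix. The initial state $(\theta_0,\omega_0)$ has distribution $\mathcal N(\xi_0,\Sigma_0\Sigma_0^\top)$ for some mean vector $\xi_0$ and covariance matrix $\Sigma_0\Sigma_0^\top$. The $\mathcal H_2$ norm of a system $\mathrm dX=AX\,\mathrm dt+R\,\mathrm dW$, $y=CX$ (here with $X=(\theta^\top,\omega^\top)^\top$, $C=\begin{bmatrix}L&0\\0&I\end{bmatrix}$, and $A$, $R$ the drift and noise matrices displayed in the claim) is defined by $$\|\mathcal G\|_2^2=\lim_{t\to\infty}\mathbb E\{y(t)^\top y(t)\}=\mathrm{trace}(C^\top P\,C),$$ where $P$ is the controllability Gramian, a positive semidefinite solution of the Lyapunov equation $AP+PA^\top=-RR^\top$, which can be taken as $P=\int_0^\infty e^{At}RR^\top e^{A^\top t}\,\mathrm dt$. *)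

theory Defs
  imports "HOL-Probability.Probability" "HOL-Computational_Algebra.Polynomial"
begin

section \<open>Weighted graphs\<close>

text \<open>The nodes are the elements of the finite type \<open>'n\<close>; an undirected edge is the two-element
  set of its endpoints.\<close>

definition simple_graph :: "'n::finite set set \<Rightarrow> bool" where
  "simple_graph E \<longleftrightarrow> (\<forall>e\<in>E. card e = 2)"

definition orientation :: "'n::finite set set \<Rightarrow> ('n set \<Rightarrow> 'n) \<Rightarrow> ('n set \<Rightarrow> 'n) \<Rightarrow> bool" where
  "orientation E src tgt \<longleftrightarrow> (\<forall>e\<in>E. e = {src e, tgt e})"

definition incidence :: "('n set \<Rightarrow> 'n) \<Rightarrow> ('n set \<Rightarrow> 'n) \<Rightarrow> 'n \<Rightarrow> 'n set \<Rightarrow> real" where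
  "incidence src tgt i e = (if i = src e then 1 else if i = tgt e then - 1 else 0)"

text \<open>The product \<open>B diag(b) B\<^sup>T\<close>, written out entrywise because the columns of the incidence matrix
  \<open>B\<close> are indexed by the set \<open>E\<close> rather than by a type.\<close>

definition laplacian ::
  "'n::finite set set \<Rightarrow> ('n set \<Rightarrow> 'n) \<Rightarrow> ('n set \<Rightarrow> 'n) \<Rightarrow> ('n set \<Rightarrow> real) \<Rightarrow> real^'n^'n" where
  "laplacian E src tgt b =
     (\<chi> i j. \<Sum>e\<in>E. incidence src tgt i e * b e * incidence src tgt j e)"


section \<open>Matrices\<close>

definition charpoly :: "real^'n^'n \<Rightarrow> real poly" where
  "charpoly A = det (\<chi> i j. (if i = j then [:0, 1:] else 0) - [:A $ i $ j:])"

text \<open>The \<open>i\<close>-th smallest real eigenvalue, counted with multiplicity; \<open>i\<close> starts at 1.\<close>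

definition eigval :: "real^'n^'n \<Rightarrow> nat \<Rightarrow> real" where
  "eigval A i = sorted_list_of_multiset (proots (charpoly A)) ! (i - 1)"

text \<open>Only meaningful for symmetric positive semidefinite \<open>A\<close>, where the root exists uniquely.\<close>

definition psd_sqrt :: "real^'n^'n \<Rightarrow> real^'n^'n" where
  "psd_sqrt A = (THE S. transpose S = S \<and> (\<forall>x. 0 \<le> x \<bullet> (S *v x)) \<and> S ** S = A)"

definition block_matrix ::
  "real^'c^'a \<Rightarrow> real^'d^'a \<Rightarrow> real^'c^'b \<Rightarrow> real^'d^'b \<Rightarrow> real^('c + 'd)^('a + 'b)" where
  "block_matrix P Q S T =
     (\<chi> i j. case i of
        Inl a \<Rightarrow> (case j of Inl c \<Rightarrow> P $ a $ c | Inr d \<Rightarrow> Q $ a $ d)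
      | Inr b \<Rightarrow> (case j of Inl c \<Rightarrow> S $ b $ c | Inr d \<Rightarrow> T $ b $ d))"

definition block_column :: "real^'c^'a \<Rightarrow> real^'c^'b \<Rightarrow> real^'c^('a + 'b)" where
  "block_column P Q = (\<chi> i j. case i of Inl a \<Rightarrow> P $ a $ j | Inr b \<Rightarrow> Q $ b $ j)"


section \<open>Gaussian laws, Wiener processes and linear stochastic systems\<close>

definition std_gaussian :: "(real^'k) measure" where
  "std_gaussian = density lborel (\<lambda>z. ennreal (\<Prod>i\<in>UNIV. normal_density 0 1 (z $ i)))"

text \<open>The normal law with mean \<open>\<xi>\<close> and covariance \<open>S S\<^sup>T\<close>. Taking the factor \<open>S\<close> as the parameter
  covers singular covariances, which have no Lebesgue density.\<close>

definition gaussian :: "real^'k \<Rightarrow> real^'k^'k \<Rightarrow> (real^'k) measure" where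
  "gaussian \<xi> S = distr std_gaussian borel (\<lambda>z. \<xi> + S *v z)"

definition wiener_process :: "'w measure \<Rightarrow> (real \<Rightarrow> 'w \<Rightarrow> real^'k) \<Rightarrow> bool" where
  "wiener_process M W \<longleftrightarrow>
     (\<forall>t\<ge>0. W t \<in> borel_measurable M) \<and>
     (AE w in M. W 0 w = 0 \<and> continuous_on {0..} (\<lambda>t. W t w)) \<and>
     (\<forall>s t. 0 \<le> s \<longrightarrow> s < t \<longrightarrow>
        distr M borel (\<lambda>w. W t w - W s w) = gaussian 0 (mat (sqrt (t - s)))) \<and>
     (\<forall>(k::nat) (\<tau>::nat \<Rightarrow> real). 0 \<le> \<tau> 0 \<longrightarrow> (\<forall>i<k. \<tau> i < \<tau> (Suc i)) \<longrightarrow>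
        prob_space.indep_vars M (\<lambda>_. borel) (\<lambda>i w. W (\<tau> (Suc i)) w - W (\<tau> i) w) {..<k})"

text \<open>Independence of the sigma-algebras generated by \<open>Z\<close> and by the whole path of \<open>W\<close>;
  \<open>indep_var\<close> does not apply because it needs both random variables to have the same type.\<close>

definition independent_of_process ::
  "'w measure \<Rightarrow> ('w \<Rightarrow> real^'l) \<Rightarrow> (real \<Rightarrow> 'w \<Rightarrow> real^'k) \<Rightarrow> bool" where
  "independent_of_process M Z W \<longleftrightarrow>
     prob_space.indep_set M
       {Z -` S \<inter> space M |S. S \<in> sets borel}
       {(\<lambda>w. \<lambda>t\<in>{0..}. W t w) -` S \<inter> space M |S. S \<in> sets (Pi\<^sub>M {0..} (\<lambda>_. borel))}"

text \<open>Solutions of \<open>dX = A X dt + R dW\<close>. Since \<open>R\<close> is constant, the stochastic integral of \<open>R\<close>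
  against \<open>W\<close> over \<open>[0, t]\<close> is \<open>R (W\<^sub>t - W\<^sub>0)\<close>, so the integrated equation makes sense pathwise.\<close>

definition linear_sde_solution ::
  "'w measure \<Rightarrow> real^'l^'l \<Rightarrow> real^'k^'l \<Rightarrow> (real \<Rightarrow> 'w \<Rightarrow> real^'k) \<Rightarrow> (real \<Rightarrow> 'w \<Rightarrow> real^'l) \<Rightarrow> bool"
  where
  "linear_sde_solution M A R W X \<longleftrightarrow>
     (\<forall>t\<ge>0. X t \<in> borel_measurable M) \<and>
     (AE w in M. continuous_on {0..} (\<lambda>t. X t w) \<and>
        (\<forall>t\<ge>0. X t w = X 0 w + integral {0..t} (\<lambda>s. A *v X s w) + R *v (W t w - W 0 w)))"

text \<open>The squared \<open>H\<^sub>2\<close> norm of the system with state process \<open>X\<close> and output \<open>y = C X\<close> exists and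
  equals \<open>v\<close>. Integrability is required because the Bochner integral is 0 otherwise.\<close>

definition has_H2_norm_sq ::
  "'w measure \<Rightarrow> real^'l^'p \<Rightarrow> (real \<Rightarrow> 'w \<Rightarrow> real^'l) \<Rightarrow> real \<Rightarrow> bool" where
  "has_H2_norm_sq M C X v \<longleftrightarrow>
     (\<forall>t\<ge>0. integrable M (\<lambda>w. (C *v X t w) \<bullet> (C *v X t w))) \<and>
     ((\<lambda>t. integral\<^sup>L M (\<lambda>w. (C *v X t w) \<bullet> (C *v X t w))) \<longlongrightarrow> v) at_top"

end

theory Submission
  imports Defs "HOL-Real_Asymp.Real_Asymp"
begin

text \<open>
  Let \<open>v\<close> be a unit eigenvector of \<open>L\<close> with eigenvalue \<open>l\<close>. The span of \<open>(v, 0)\<close> and \<open>(0, v)\<close> is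
  invariant under \<open>A\<^sup>T\<close>, so pairing the state with a solution of the adjoint equation in this plane
  expresses \<open>v \<bullet> \<theta>(t)\<close> and \<open>v \<bullet> \<omega>(t)\<close> as a decaying functional of the initial state plus a Wiener
  integral of a deterministic function. The variance of the latter is \<open>\<gamma> / d\<close> times the energy
  \<open>(\<alpha>\<^sup>2 + l \<beta>\<^sup>2 / m) / 2\<close> that a damped oscillator dissipates, so in the limit \<open>v \<bullet> \<theta>\<close> has variance
  \<open>\<gamma> / (2 d)\<close> (if \<open>l > 0\<close>) and \<open>v \<bullet> \<omega>\<close> has variance \<open>\<gamma> l / (2 d m)\<close>. The output energy is the sum
  over an orthonormal eigenbasis of \<open>l\<^sup>2 (v \<bullet> \<theta>)\<^sup>2 + (v \<bullet> \<omega>)\<^sup>2\<close>.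
\<close>

section \<open>Gaussian moments\<close>

text \<open>The state is known only through a pathwise integral equation, and nothing is assumed
  about the moments of \<open>X t\<close> for t > 0, so integrability has to come out together with
  the value. Since \<open>R\<close> is constant, the adjoint pairing involves only a smooth
  deterministic integrand, whose Wiener integral can be defined path by path through integration by
  parts. The drift matrix is not Hurwitz: on the kernel of \<open>L\<close> the phase does not relax
  and remembers the initial state. The output sees the phase only through \<open>L\<close>, that is
  with weight l, so the kernel contributes nothing but its velocity, which decays. The factor
  \<gamma> / (2 d) is the same in every mode because of the noise shape L^(1/2): it puts a factor l
  into the noise intensity, matching the factor l in the dissipation rate. Second moments are
  tracked rather than variances, so a nonzero initial mean needs no separate treatment: the Wiener
  part is centred and independent of the initial state, hence there is no cross term.\<close>

lemma Basis_vec_eq_axis: "(Basis :: (real^'k::finite) set) = range (\<lambda>i. axis i 1)"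
  by (auto simp: Basis_vec_def)

lemma inj_axis_one: "inj (\<lambda>i::'k::finite. axis i (1::real))"
  by (auto simp: inj_on_def axis_eq_axis)

text \<open>\<open>lborel\<close> on \<open>real^'k\<close> is the image of the product measure over
  \<open>Basis\<close>, so Fubini for finite products applies once the factors are indexed by basis
  vectors; inverting the axis map transports the index.\<close>

lemma has_bochner_integral_lborel_prod:
  fixes g :: "'k::finite \<Rightarrow> real \<Rightarrow> real"
  assumes g: "\<And>i. has_bochner_integral lborel (g i) (c i)"
  shows "has_bochner_integral lborel (\<lambda>x::real^'k. \<Prod>i\<in>UNIV. g i (x $ i)) (\<Prod>i\<in>UNIV. c i)"
proof -
  interpret product_sigma_finite "\<lambda>_::real^'k. lborel::real measure"
    by (simp add: product_sigma_finite_def sigma_finite_lborel)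
  define h where "h b = g (inv (\<lambda>i::'k. axis i (1::real)) b)" for b :: "real^'k"
  have h_axis: "h (axis i 1) = g i" for i
    by (simp add: h_def inv_f_f[OF inj_axis_one])
  have int_h: "integrable lborel (h b)" for b
    using g by (auto simp: h_def has_bochner_integral_iff)
  have val_h: "integral\<^sup>L lborel (h (axis i 1)) = c i" for i
    using g by (auto simp: h_axis has_bochner_integral_iff)
  have reindex: "(\<Prod>b\<in>Basis. F b) = (\<Prod>i\<in>UNIV. F (axis i 1))" for F :: "real^'k \<Rightarrow> real"
    unfolding Basis_vec_eq_axis by (simp add: prod.reindex[OF inj_axis_one])
  have pull: "(\<Prod>i\<in>UNIV. g i ((\<Sum>b\<in>Basis. f b *\<^sub>R b) $ i)) = (\<Prod>b\<in>Basis. h b (f b))"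
    for f :: "real^'k \<Rightarrow> real"
  proof -
    have "(\<Sum>b\<in>Basis. f b *\<^sub>R b) $ i = f (axis i 1)" for i
    proof -
      have "(\<Sum>b\<in>Basis. f b *\<^sub>R b) \<bullet> axis i 1 = f (axis i 1)"
        by (rule inner_sum_left_Basis) (auto simp: Basis_vec_eq_axis)
      then show ?thesis by (simp add: inner_axis)
    qed
    then show ?thesis by (simp add: reindex h_axis)
  qed
  have meas: "(\<lambda>f. \<Sum>b\<in>Basis. f b *\<^sub>R b) \<in> (\<Pi>\<^sub>M b\<in>(Basis::(real^'k) set). lborel) \<rightarrow>\<^sub>M borel"
    by measurable
  have "has_bochner_integral (\<Pi>\<^sub>M b\<in>(Basis::(real^'k) set). lborel)
      (\<lambda>f. \<Prod>b\<in>Basis. h b (f b)) (\<Prod>i\<in>UNIV. c i)"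
    unfolding has_bochner_integral_iff
    using product_integrable_prod[of Basis h] product_integral_prod[of Basis h] int_h
    by (simp add: reindex[of "\<lambda>b. integral\<^sup>L lborel (h b)"] val_h)
  moreover have [measurable]: "g i \<in> borel_measurable borel" for i
    using g[of i] by (auto dest: borel_measurable_has_bochner_integral)
  ultimately show ?thesis
    by (subst lborel_eq, intro has_bochner_integral_distr[OF _ meas])
       (simp_all add: pull del: sum_component)
qed

lemma std_normal_moments:
  shows "has_bochner_integral lborel std_normal_density 1"
    and "has_bochner_integral lborel (\<lambda>x. std_normal_density x * x) 0"
    and "has_bochner_integral lborel (\<lambda>x. std_normal_density x * x\<^sup>2) 1"
  using std_normal_moment_even[of 0] std_normal_moment_odd[of 0] std_normal_moment_even[of 1]
  by (simp_all add: fact_2)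

text \<open>Density and integrand are both products over the coordinates, so mixed moments factor
  into one-dimensional ones. Every monomial needed later has this form, with the factor 1 at the
  coordinates that do not occur in it.\<close>

lemma has_bochner_integral_std_gaussian:
  fixes g :: "'k::finite \<Rightarrow> real \<Rightarrow> real"
  assumes g: "\<And>i. has_bochner_integral lborel (\<lambda>x. std_normal_density x * g i x) (c i)"
    and [measurable]: "\<And>i. g i \<in> borel_measurable borel"
  shows "has_bochner_integral std_gaussian (\<lambda>z::real^'k. \<Prod>i\<in>UNIV. g i (z $ i)) (\<Prod>i\<in>UNIV. c i)"
proof -
  have "has_bochner_integral lborel
     (\<lambda>z::real^'k. (\<Prod>i\<in>UNIV. normal_density 0 1 (z $ i)) *\<^sub>R (\<Prod>i\<in>UNIV. g i (z $ i))) (\<Prod>i\<in>UNIV. c i)"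
    using has_bochner_integral_lborel_prod[OF g] by (simp add: prod.distrib)
  then show ?thesis
    unfolding std_gaussian_def
    by (intro has_bochner_integral_density) (auto intro!: AE_I2 prod_nonneg)
qed

lemma std_gaussian_second_moment:
  "has_bochner_integral std_gaussian (\<lambda>z::real^'k::finite. z $ i * z $ j) (if i = j then 1 else 0)"
proof (cases "i = j")
  case True
  have "has_bochner_integral std_gaussian
     (\<lambda>z::real^'k. \<Prod>l\<in>UNIV. (if l = i then (z $ l)\<^sup>2 else 1)) (\<Prod>l\<in>(UNIV::'k set). 1)"
  proof (rule has_bochner_integral_std_gaussian[where g="\<lambda>l x. if l = i then x\<^sup>2 else 1"])
    show "has_bochner_integral lborel (\<lambda>x. std_normal_density x * (if l = i then x\<^sup>2 else 1)) 1" for l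
      by (cases "l = i") (use std_normal_moments in auto)
  qed auto
  moreover have "(\<Prod>l\<in>UNIV. (if l = i then (z $ l)\<^sup>2 else 1)) = (z $ i)\<^sup>2" for z :: "real^'k"
    by (simp add: prod.delta)
  ultimately show ?thesis using True by (simp add: power2_eq_square)
next
  case False
  have "has_bochner_integral std_gaussian
     (\<lambda>z::real^'k. \<Prod>l\<in>UNIV. (if l = i \<or> l = j then z $ l else 1))
     (\<Prod>l\<in>UNIV. if l = i \<or> l = j then 0 else 1)"
  proof (rule has_bochner_integral_std_gaussian[where g="\<lambda>l x. if l = i \<or> l = j then x else 1"])
    show "has_bochner_integral lborel (\<lambda>x. std_normal_density x * (if l = i \<or> l = j then x else 1))
        (if l = i \<or> l = j then 0 else 1)" for l
      by (cases "l = i \<or> l = j") (use std_normal_moments in auto)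
  qed auto
  moreover have "(\<Prod>l\<in>UNIV. (if l = i \<or> l = j then z $ l else 1)) = z $ i * z $ j"
    for z :: "real^'k"
  proof -
    have "(\<Prod>l\<in>UNIV. (if l = i \<or> l = j then z $ l else 1))
        = (\<Prod>l\<in>UNIV. (if l = i then z $ l else 1) * (if l = j then z $ l else 1))"
      by (rule prod.cong) (use False in auto)
    then show ?thesis by (simp add: prod.distrib prod.delta)
  qed
  moreover have "(\<Prod>l\<in>(UNIV::'k set). if l = i \<or> l = j then 0 else 1::real) = 0"
    by (auto simp: prod_zero_iff)
  ultimately show ?thesis using False by simp
qed

lemma std_gaussian_first_moment:
  "has_bochner_integral std_gaussian (\<lambda>z::real^'k::finite. z $ i) 0"
proof -
  have "has_bochner_integral std_gaussian
     (\<lambda>z::real^'k. \<Prod>l\<in>UNIV. (if l = i then z $ l else 1)) (\<Prod>l\<in>UNIV. if l = i then 0 else 1)"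
  proof (rule has_bochner_integral_std_gaussian[where g="\<lambda>l x. if l = i then x else 1"])
    show "has_bochner_integral lborel (\<lambda>x. std_normal_density x * (if l = i then x else 1))
        (if l = i then 0 else 1)" for l
      by (cases "l = i") (use std_normal_moments in auto)
  qed auto
  moreover have "(\<Prod>l\<in>UNIV. (if l = i then z $ l else 1)) = z $ i" for z :: "real^'k"
    by (simp add: prod.delta)
  ultimately show ?thesis by auto
qed

text \<open>The total mass is the moment of the empty monomial.\<close>

lemma prob_space_std_gaussian: "prob_space (std_gaussian :: (real^'k::finite) measure)"
proof -
  have "has_bochner_integral std_gaussian (\<lambda>z::real^'k. \<Prod>l\<in>(UNIV::'k set). 1::real) (\<Prod>l\<in>(UNIV::'k set). 1)"
    by (rule has_bochner_integral_std_gaussian[where g="\<lambda>l x. 1::real"]) (use std_normal_moments in auto)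
  then have int: "has_bochner_integral std_gaussian (\<lambda>z::real^'k. 1) (1::real)" by simp
  then have "(\<integral>\<^sup>+z. ennreal 1 \<partial>(std_gaussian :: (real^'k) measure)) = ennreal 1"
    by (subst nn_integral_eq_integral) (auto simp: has_bochner_integral_iff)
  then have "emeasure std_gaussian (space (std_gaussian :: (real^'k) measure)) = 1"
    by simp
  then show ?thesis by (rule prob_spaceI)
qed

lemma std_gaussian_inner_moments:
  fixes u :: "real^'k::finite"
  shows "has_bochner_integral std_gaussian (\<lambda>z. u \<bullet> z) 0"
    and "has_bochner_integral std_gaussian (\<lambda>z. (u \<bullet> z)\<^sup>2) ((norm u)\<^sup>2)"
proof -
  have "has_bochner_integral std_gaussian (\<lambda>z. \<Sum>i\<in>UNIV. u $ i * z $ i) (\<Sum>i\<in>(UNIV::'k set). u $ i * 0)"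
    by (intro has_bochner_integral_sum has_bochner_integral_mult_right std_gaussian_first_moment)
  then show "has_bochner_integral std_gaussian (\<lambda>z. u \<bullet> z) 0"
    by (simp add: inner_vec_def)
  have "has_bochner_integral std_gaussian
      (\<lambda>z. \<Sum>i\<in>UNIV. \<Sum>j\<in>UNIV. (u $ i * u $ j) * (z $ i * z $ j))
      (\<Sum>i\<in>UNIV. \<Sum>j\<in>UNIV. (u $ i * u $ j) * (if i = j then 1 else 0))"
    by (intro has_bochner_integral_sum has_bochner_integral_mult_right std_gaussian_second_moment)
  moreover have "(u \<bullet> z)\<^sup>2 = (\<Sum>i\<in>UNIV. \<Sum>j\<in>UNIV. (u $ i * u $ j) * (z $ i * z $ j))" for z
    by (simp add: inner_vec_def power2_eq_square sum_product mult_ac)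
  moreover have "(norm u)\<^sup>2 = (\<Sum>i\<in>UNIV. \<Sum>j\<in>UNIV. (u $ i * u $ j) * (if i = j then 1 else 0))"
    unfolding power2_norm_eq_inner by (simp add: inner_vec_def if_distrib cong: if_cong)
  ultimately show "has_bochner_integral std_gaussian (\<lambda>z. (u \<bullet> z)\<^sup>2) ((norm u)\<^sup>2)"
    by simp
qed

lemma mat_mult_vec: "(mat c :: real^'k^'k) *v z = c *\<^sub>R z"
  by (simp add: vec_eq_iff matrix_vector_mult_def mat_def if_distrib if_distribR sum.delta cong: if_cong)

lemma measurable_affine: "(\<lambda>z::real^'k::finite. \<xi> + S *v z) \<in> std_gaussian \<rightarrow>\<^sub>M (borel :: (real^'l::finite) measure)"
proof -
  have "(\<lambda>z. \<xi> + S *v z) \<in> borel \<rightarrow>\<^sub>M borel"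
    by (intro borel_measurable_continuous_onI continuous_intros)
  then show ?thesis by (simp add: std_gaussian_def)
qed

lemma centered_gaussian_inner_moments:
  fixes u :: "real^'k::finite"
  shows "has_bochner_integral (gaussian 0 (mat c)) (\<lambda>z. u \<bullet> z) 0"
    and "has_bochner_integral (gaussian 0 (mat c)) (\<lambda>z. (u \<bullet> z)\<^sup>2) (c\<^sup>2 * (norm u)\<^sup>2)"
proof -
  note m = measurable_affine[of "0::real^'k" "mat c"]
  show "has_bochner_integral (gaussian 0 (mat c)) (\<lambda>z. u \<bullet> z) 0"
    unfolding gaussian_def
    using has_bochner_integral_mult_right[OF std_gaussian_inner_moments(1)[of u], of c]
    by (subst has_bochner_integral_distr[OF _ m]) (simp_all add: mat_mult_vec)
  show "has_bochner_integral (gaussian 0 (mat c)) (\<lambda>z. (u \<bullet> z)\<^sup>2) (c\<^sup>2 * (norm u)\<^sup>2)"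
    unfolding gaussian_def
    using has_bochner_integral_mult_right[OF std_gaussian_inner_moments(2)[of u], of "c\<^sup>2"]
    by (subst has_bochner_integral_distr[OF _ m]) (simp_all add: mat_mult_vec power_mult_distrib)
qed

lemma integrable_gaussian_norm_sq:
  fixes \<xi> :: "real^'k::finite"
  shows "integrable (gaussian \<xi> S) (\<lambda>x. (norm x)\<^sup>2)"
proof -
  interpret prob_space "std_gaussian :: (real^'k) measure" by (rule prob_space_std_gaussian)
  have "integrable std_gaussian (\<lambda>z. (\<xi> $ i + S $ i \<bullet> z)\<^sup>2)" for i
  proof -
    have "integrable std_gaussian (\<lambda>z. (\<xi> $ i)\<^sup>2 + 2 * \<xi> $ i * (S $ i \<bullet> z) + (S $ i \<bullet> z)\<^sup>2)"
      using std_gaussian_inner_moments[of "S $ i"]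
      by (intro Bochner_Integration.integrable_add integrable_mult_right) (auto simp: has_bochner_integral_iff)
    then show ?thesis by (simp add: power2_sum algebra_simps)
  qed
  then have "integrable std_gaussian (\<lambda>z. \<Sum>i\<in>UNIV. (\<xi> $ i + S $ i \<bullet> z)\<^sup>2)" by auto
  moreover have "(norm (\<xi> + S *v z))\<^sup>2 = (\<Sum>i\<in>UNIV. (\<xi> $ i + S $ i \<bullet> z)\<^sup>2)" for z
    unfolding power2_norm_eq_inner
    by (simp add: inner_vec_def matrix_vector_mult_def power2_eq_square)
  ultimately show ?thesis
    unfolding gaussian_def by (subst integrable_distr_eq[OF measurable_affine]) simp_all
qed

section \<open>Moments of Wiener increments\<close>

text \<open>Preimages of a sigma-algebra form a pi-system, which is what carries independence over
  to the generated sigma-algebras.\<close>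

lemma Int_stable_preimages: "Int_stable {f -` S \<inter> U |S. S \<in> sets N}"
proof (rule Int_stableI, clarify)
  fix S T assume "S \<in> sets N" "T \<in> sets N"
  then show "\<exists>S'. f -` S \<inter> U \<inter> (f -` T \<inter> U) = f -` S' \<inter> U \<and> S' \<in> sets N"
    by (intro exI[of _ "S \<inter> T"]) auto
qed

context prob_space
begin

text \<open>Pythagoras in L2: a new summand is independent of the partial sum and both are centred,
  so the cross term integrates to a product of zero means.\<close>

lemma indep_vars_centered_sum_second_moment:
  fixes Y :: "'i \<Rightarrow> 'a \<Rightarrow> real"
  assumes "finite I" and "indep_vars (\<lambda>_. borel) Y I"
    and "\<And>i. i \<in> I \<Longrightarrow> has_bochner_integral M (Y i) 0"
    and "\<And>i. i \<in> I \<Longrightarrow> has_bochner_integral M (\<lambda>w. (Y i w)\<^sup>2) (v i)"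
  shows "has_bochner_integral M (\<lambda>w. (\<Sum>i\<in>I. Y i w)\<^sup>2) (\<Sum>i\<in>I. v i)"
  using assms
proof (induction I rule: finite_induct)
  case empty
  then show ?case by (simp add: has_bochner_integral_zero)
next
  case (insert n I)
  let ?S = "\<lambda>w. \<Sum>i\<in>I. Y i w"
  have S2: "has_bochner_integral M (\<lambda>w. (?S w)\<^sup>2) (\<Sum>i\<in>I. v i)"
    using insert by (intro insert.IH) (auto intro: indep_vars_subset)
  have S1: "has_bochner_integral M ?S (\<Sum>i\<in>I. 0)"
    using insert by (intro has_bochner_integral_sum) auto
  have Y1: "has_bochner_integral M (Y n) 0" and Y2: "has_bochner_integral M (\<lambda>w. (Y n w)\<^sup>2) (v n)"
    using insert by auto
  have indep: "indep_var borel (Y n) borel ?S"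
    using insert by (intro indep_vars_sum) auto
  have int: "integrable M (Y n)" "integrable M ?S"
    using S1 Y1 by (auto simp: has_bochner_integral_iff)
  have cross: "has_bochner_integral M (\<lambda>w. Y n w * ?S w) 0"
    using indep_var_lebesgue_integral[OF indep int] indep_var_integrable[OF indep int] S1 Y1
    by (simp add: has_bochner_integral_iff)
  have "has_bochner_integral M (\<lambda>w. (Y n w)\<^sup>2 + 2 * (Y n w * ?S w) + (?S w)\<^sup>2) (v n + 2 * 0 + (\<Sum>i\<in>I. v i))"
    by (intro has_bochner_integral_add has_bochner_integral_mult_right Y2 cross S2)
  then show ?case
    using insert.hyps by (simp add: power2_sum algebra_simps)
qed

lemma wiener_increment_moments:
  fixes W :: "real \<Rightarrow> 'a \<Rightarrow> real^'k::finite"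
  assumes W: "wiener_process M W" and st: "0 \<le> s" "s < t"
  shows "has_bochner_integral M (\<lambda>w. u \<bullet> (W t w - W s w)) 0"
    and "has_bochner_integral M (\<lambda>w. (u \<bullet> (W t w - W s w))\<^sup>2) ((norm u)\<^sup>2 * (t - s))"
proof -
  have [measurable]: "W t \<in> borel_measurable M" "W s \<in> borel_measurable M"
    and d: "distr M borel (\<lambda>w. W t w - W s w) = gaussian 0 (mat (sqrt (t - s)))"
    using W st by (auto simp: wiener_process_def)
  have m: "(\<lambda>w. W t w - W s w) \<in> M \<rightarrow>\<^sub>M borel" by simp
  note g = centered_gaussian_inner_moments[of "sqrt (t - s)" u, folded d]
  show "has_bochner_integral M (\<lambda>w. u \<bullet> (W t w - W s w)) 0"
    using g(1) by (simp add: has_bochner_integral_iff integrable_distr_eq[OF m] integral_distr[OF m])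
  show "has_bochner_integral M (\<lambda>w. (u \<bullet> (W t w - W s w))\<^sup>2) ((norm u)\<^sup>2 * (t - s))"
    using g(2) st
    by (simp add: has_bochner_integral_iff integrable_distr_eq[OF m] integral_distr[OF m] mult.commute)
qed

text \<open>The Ito isometry for a deterministic step integrand. The times increase strictly because
  \<open>wiener_process\<close> states independence for such sequences.\<close>

lemma wiener_sum_second_moment:
  fixes W :: "real \<Rightarrow> 'a \<Rightarrow> real^'k::finite" and k :: nat
  assumes W: "wiener_process M W" and \<tau>: "0 \<le> \<tau> 0" "\<And>i. i < k \<Longrightarrow> \<tau> i < \<tau> (Suc i)"
  shows "has_bochner_integral M (\<lambda>w. (\<Sum>i<k. u i \<bullet> (W (\<tau> (Suc i)) w - W (\<tau> i) w))\<^sup>2)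
           (\<Sum>i<k. (norm (u i))\<^sup>2 * (\<tau> (Suc i) - \<tau> i))"
proof -
  have nonneg: "0 \<le> \<tau> i" if "i < k" for i
    using that
  proof (induction i)
    case (Suc i)
    then show ?case using \<tau>(2)[of i] by simp
  qed (use \<tau> in simp)
  have "indep_vars (\<lambda>_. borel) (\<lambda>i w. W (\<tau> (Suc i)) w - W (\<tau> i) w) {..<k}"
    using W \<tau> by (auto simp: wiener_process_def)
  then have "indep_vars (\<lambda>_. borel) (\<lambda>i w. u i \<bullet> (W (\<tau> (Suc i)) w - W (\<tau> i) w)) {..<k}"
    by (rule indep_vars_compose2) simp
  then show ?thesis
    using wiener_increment_moments[OF W nonneg \<tau>(2)]
    by (intro indep_vars_centered_sum_second_moment) auto
qed

lemma independent_of_process_increment: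
  fixes Z :: "'a \<Rightarrow> real^'l::finite" and W :: "real \<Rightarrow> 'a \<Rightarrow> real^'k::finite"
  assumes W: "wiener_process M W" and ind: "independent_of_process M Z W"
    and [measurable]: "Z \<in> borel_measurable M" and st: "0 \<le> s" "0 \<le> t"
  shows "indep_var borel (\<lambda>w. p \<bullet> Z w) borel (\<lambda>w. u \<bullet> (W t w - W s w))"
proof -
  have [measurable]: "W t \<in> borel_measurable M" "W s \<in> borel_measurable M"
    using W st by (auto simp: wiener_process_def)
  let ?A = "{Z -` S \<inter> space M |S. S \<in> sets borel}"
  let ?B = "{(\<lambda>w. \<lambda>t\<in>{0..}. W t w) -` S \<inter> space M |S. S \<in> sets (Pi\<^sub>M {0..} (\<lambda>_. borel))}"
  have AB: "indep_set ?A ?B" using ind by (simp add: independent_of_process_def)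
  \<comment> \<open>The increment as a function on path space; \<open>s\<close> and \<open>t\<close>
    are coordinates of the product over \<open>{0..}\<close> because they are nonnegative.\<close>
  define h where "h f = u \<bullet> (f t - f s)" for f :: "real \<Rightarrow> real^'k"
  have h[measurable]: "h \<in> Pi\<^sub>M {0..} (\<lambda>_. borel) \<rightarrow>\<^sub>M borel"
    unfolding h_def
    by (intro borel_measurable_inner borel_measurable_diff borel_measurable_const
        measurable_component_singleton) (use st in auto)
  have A: "{(\<lambda>w. p \<bullet> Z w) -` S \<inter> space M |S. S \<in> sets borel} \<subseteq> ?A"
  proof safe
    fix S :: "real set" assume "S \<in> sets borel"
    then have "(\<lambda>z::real^'l. p \<bullet> z) -` S \<inter> space borel \<in> sets borel"
      by (intro measurable_sets) auto
    then show "\<exists>S'. (\<lambda>w. p \<bullet> Z w) -` S \<inter> space M = Z -` S' \<inter> space M \<and> S' \<in> sets borel"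
      by (intro exI[of _ "(\<lambda>z::real^'l. p \<bullet> z) -` S"]) auto
  qed
  have B: "{(\<lambda>w. u \<bullet> (W t w - W s w)) -` S \<inter> space M |S. S \<in> sets borel} \<subseteq> ?B"
  proof safe
    fix S :: "real set" assume "S \<in> sets borel"
    then have "h -` S \<inter> space (Pi\<^sub>M {0..} (\<lambda>_. borel)) \<in> sets (Pi\<^sub>M {0..} (\<lambda>_. borel))"
      by (intro measurable_sets[OF h]) auto
    then show "\<exists>S'. (\<lambda>w. u \<bullet> (W t w - W s w)) -` S \<inter> space M
        = (\<lambda>w. \<lambda>t\<in>{0..}. W t w) -` S' \<inter> space M \<and> S' \<in> sets (Pi\<^sub>M {0..} (\<lambda>_. borel))"
      using st by (intro exI[of _ "h -` S \<inter> space (Pi\<^sub>M {0..} (\<lambda>_. borel))"])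
        (auto simp: h_def space_PiM)
  qed
  have "indep_set {(\<lambda>w. p \<bullet> Z w) -` S \<inter> space M |S. S \<in> sets borel}
      {(\<lambda>w. u \<bullet> (W t w - W s w)) -` S \<inter> space M |S. S \<in> sets borel}"
    using AB[unfolded indep_sets2_eq] A B by (intro indep_setI) (meson subset_iff subset_trans)+
  then have "indep_set (sigma_sets (space M) {(\<lambda>w. p \<bullet> Z w) -` S \<inter> space M |S. S \<in> sets borel})
      (sigma_sets (space M) {(\<lambda>w. u \<bullet> (W t w - W s w)) -` S \<inter> space M |S. S \<in> sets borel})"
    by (rule indep_set_sigma_sets) (intro Int_stable_preimages)+
  then show ?thesis by (simp add: indep_var_eq)
qed

text \<open>Fatou's lemma for squares: a uniform bound on second moments survives an almost sure
  limit without a dominating function.\<close>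

lemma square_integrable_AE_limit:
  fixes V :: "nat \<Rightarrow> 'a \<Rightarrow> real"
  assumes [measurable]: "\<And>q. V q \<in> borel_measurable M" "U \<in> borel_measurable M"
    and lim: "AE w in M. (\<lambda>q. V q w) \<longlonglongrightarrow> U w"
    and int: "\<And>q. integrable M (\<lambda>w. (V q w)\<^sup>2)" and bound: "\<And>q. (\<integral>w. (V q w)\<^sup>2 \<partial>M) \<le> c"
  shows "integrable M (\<lambda>w. (U w)\<^sup>2)" and "(\<integral>w. (U w)\<^sup>2 \<partial>M) \<le> c"
proof -
  \<comment> \<open>Nonnegativity of \<open>c\<close> lets the final bound return from
    \<open>ennreal\<close> to the reals.\<close>
  have "0 \<le> (\<integral>w. (V 0 w)\<^sup>2 \<partial>M)"
    by (rule Bochner_Integration.integral_nonneg) simp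
  then have c: "0 \<le> c" using bound[of 0] by linarith
  have "(\<integral>\<^sup>+w. ennreal ((U w)\<^sup>2) \<partial>M) = (\<integral>\<^sup>+w. liminf (\<lambda>q. ennreal ((V q w)\<^sup>2)) \<partial>M)"
  proof (rule nn_integral_cong_AE, use lim in eventually_elim)
    case (elim w)
    then have "(\<lambda>q. ennreal ((V q w)\<^sup>2)) \<longlonglongrightarrow> ennreal ((U w)\<^sup>2)"
      by (intro tendsto_ennrealI tendsto_power)
    from lim_imp_Liminf[OF trivial_limit_sequentially this] show ?case by simp
  qed
  also have "\<dots> \<le> liminf (\<lambda>q. \<integral>\<^sup>+w. ennreal ((V q w)\<^sup>2) \<partial>M)"
    by (rule nn_integral_liminf) simp
  also have "\<dots> \<le> ennreal c"
  proof (rule Liminf_le)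
    show "\<forall>\<^sub>F q in sequentially. (\<integral>\<^sup>+w. ennreal ((V q w)\<^sup>2) \<partial>M) \<le> ennreal c"
      using int bound by (intro always_eventually allI, subst nn_integral_eq_integral) (auto intro: ennreal_leI)
  qed simp
  finally have le: "(\<integral>\<^sup>+w. ennreal ((U w)\<^sup>2) \<partial>M) \<le> ennreal c" .
  show int_U: "integrable M (\<lambda>w. (U w)\<^sup>2)"
    using le by (intro integrableI_nonneg) (auto simp: less_top[symmetric] top_unique)
  show "(\<integral>w. (U w)\<^sup>2 \<partial>M) \<le> c"
    using le c nn_integral_eq_integral[OF int_U] by simp
qed

end

section \<open>Left-point sums along continuous paths\<close>

lemma sum_integral_partition:
  fixes h :: "real \<Rightarrow> 'a::banach" and t :: real
  assumes h: "h integrable_on {0..t}" and t: "0 \<le> t" and "n \<le> N" "0 < N"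
  shows "(\<Sum>i<n. integral {t * real i / real N..t * real (Suc i) / real N} h) = integral {0..t * real n / real N} h"
  using \<open>n \<le> N\<close>
proof (induction n)
  case (Suc n)
  let ?s = "\<lambda>i. t * real i / real N"
  have mono: "0 \<le> ?s n" "?s n \<le> ?s (Suc n)"
    using t by (auto intro!: divide_right_mono mult_left_mono)
  have "?s (Suc n) \<le> t"
    using Suc.prems t \<open>0 < N\<close> by (simp add: divide_le_eq mult_left_mono)
  then have "h integrable_on {0..?s (Suc n)}"
    by (intro integrable_on_subinterval[OF h]) auto
  then show ?case
    using Suc Henstock_Kurzweil_Integration.integral_combine[OF mono] by simp
qed simp

lemma partition_bounds:
  fixes t :: real
  assumes "0 \<le> t" "i < N"
  shows "0 \<le> t * real i / real N" "t * real i / real N \<le> t * real (Suc i) / real N"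
    "t * real (Suc i) / real N \<le> t" "t * real (Suc i) / real N - t * real i / real N = t / real N"
proof -
  show "0 \<le> t * real i / real N" "t * real i / real N \<le> t * real (Suc i) / real N"
    using assms by (auto intro!: divide_right_mono mult_left_mono)
  have "t * real (Suc i) \<le> t * real N"
    using assms by (intro mult_left_mono) auto
  then show "t * real (Suc i) / real N \<le> t"
    using assms by (simp add: divide_le_eq)
  show "t * real (Suc i) / real N - t * real i / real N = t / real N"
    by (simp add: distrib_left add_divide_distrib)
qed

text \<open>Each cell integrates \<open>f\<close> exactly, so the error comes from the oscillation
  of \<open>g\<close> alone, which is uniformly continuous. The tag \<tau> is left free because
  right endpoints arise after summation by parts and left endpoints in the sums produced by the
  isometry.\<close>

lemma tendsto_partition_sums:
  fixes f g :: "real \<Rightarrow> 'a::euclidean_space" and t :: real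
  assumes f: "continuous_on {0..t} f" and g: "continuous_on {0..t} g" and t: "0 \<le> t"
    and \<tau>: "\<And>N i. i < N \<Longrightarrow> \<tau> N i \<in> {t * real i / real N..t * real (Suc i) / real N}"
  shows "(\<lambda>N. \<Sum>i<N. integral {t * real i / real N..t * real (Suc i) / real N} f \<bullet> g (\<tau> N i))
           \<longlonglongrightarrow> integral {0..t} (\<lambda>s. f s \<bullet> g s)"
proof (rule LIMSEQ_I)
  fix e :: real assume e: "0 < e"
  obtain K where K: "0 < K" "\<And>s. s \<in> {0..t} \<Longrightarrow> norm (f s) \<le> K"
    using compact_continuous_image[OF f] bounded_pos[of "f ` {0..t}"] compact_imp_bounded by auto
  \<comment> \<open>The total error is at most \<open>K * e' * t = e * t / (t + 1)\<close>, which is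
    strictly below \<open>e\<close> and makes sense also for \<open>t = 0\<close>.\<close>
  define e' where "e' = e / (K * (t + 1))"
  have e': "0 < e'" using e K t by (simp add: e'_def)
  have "uniformly_continuous_on {0..t} g"
    using g by (rule compact_uniformly_continuous) simp
  then obtain \<delta> where \<delta>: "0 < \<delta>"
    "\<And>x y. x \<in> {0..t} \<Longrightarrow> y \<in> {0..t} \<Longrightarrow> dist x y < \<delta> \<Longrightarrow> dist (g x) (g y) < e'"
    unfolding uniformly_continuous_on_def using e' by metis
  obtain N0 :: nat where N0: "t / \<delta> < real N0" using reals_Archimedean2 by blast
  show "\<exists>no. \<forall>N\<ge>no. norm ((\<Sum>i<N. integral {t * real i / real N..t * real (Suc i) / real N} f \<bullet> g (\<tau> N i))
      - integral {0..t} (\<lambda>s. f s \<bullet> g s)) < e"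
  proof (intro exI allI impI)
    fix N assume "Suc N0 \<le> N"
    then have N: "0 < N" "t / \<delta> < real N" using N0 by auto
    then have tN: "t / real N < \<delta>" using \<delta>(1) by (simp add: field_simps)
    let ?I = "\<lambda>i. {t * real i / real N..t * real (Suc i) / real N}"
    have sub: "?I i \<subseteq> {0..t}" if "i < N" for i
      using partition_bounds[OF t that] by auto
    have each: "norm (integral (?I i) f \<bullet> g (\<tau> N i) - integral (?I i) (\<lambda>s. f s \<bullet> g s)) \<le> K * e' * (t / real N)"
      if i: "i < N" for i
    proof -
      have fi: "f integrable_on ?I i" and fgi: "(\<lambda>s. f s \<bullet> g s) integrable_on ?I i"
        by (intro integrable_continuous_interval continuous_intros continuous_on_subset[OF f sub[OF i]]
            continuous_on_subset[OF g sub[OF i]])+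
      have fi': "(\<lambda>s. f s \<bullet> g (\<tau> N i)) integrable_on ?I i"
        by (intro integrable_continuous_interval continuous_intros continuous_on_subset[OF f sub[OF i]])
      have "integral (?I i) f \<bullet> g (\<tau> N i) = integral (?I i) (\<lambda>s. f s \<bullet> g (\<tau> N i))"
        using integral_linear[OF fi bounded_linear_inner_left[of "g (\<tau> N i)"]] by (simp add: o_def)
      then have "integral (?I i) f \<bullet> g (\<tau> N i) - integral (?I i) (\<lambda>s. f s \<bullet> g s)
          = integral (?I i) (\<lambda>s. f s \<bullet> g (\<tau> N i) - f s \<bullet> g s)"
        using integral_diff[OF fi' fgi] by simp
      also have "norm \<dots> \<le> K * e' * (t * real (Suc i) / real N - t * real i / real N)"
      proof (rule integral_bound)
        show "t * real i / real N \<le> t * real (Suc i) / real N"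
          using partition_bounds[OF t i] by simp
        show "continuous_on (?I i) (\<lambda>s. f s \<bullet> g (\<tau> N i) - f s \<bullet> g s)"
          by (intro continuous_intros continuous_on_subset[OF f sub[OF i]] continuous_on_subset[OF g sub[OF i]])
        fix s assume s: "s \<in> ?I i"
        have "dist (\<tau> N i) s \<le> t / real N"
          using \<tau>[OF i] s partition_bounds(4)[OF t i] by (auto simp: dist_real_def)
        then have "dist (g (\<tau> N i)) (g s) < e'"
          using tN \<tau>[OF i] s sub[OF i] by (intro \<delta>(2)) auto
        moreover have "norm (f s \<bullet> (g (\<tau> N i) - g s)) \<le> norm (f s) * norm (g (\<tau> N i) - g s)"
          using Cauchy_Schwarz_ineq2 by auto
        moreover have "norm (f s) * norm (g (\<tau> N i) - g s) \<le> K * e'"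
          using K sub[OF i] s calculation(1) by (intro mult_mono) (auto simp: dist_norm)
        ultimately show "norm (f s \<bullet> g (\<tau> N i) - f s \<bullet> g s) \<le> K * e'"
          by (simp add: inner_diff_right)
      qed
      finally show ?thesis using partition_bounds(4)[OF t i] by simp
    qed
    have "(\<lambda>s. f s \<bullet> g s) integrable_on {0..t}"
      by (intro integrable_continuous_interval continuous_intros f g)
    then have "integral {0..t} (\<lambda>s. f s \<bullet> g s) = (\<Sum>i<N. integral (?I i) (\<lambda>s. f s \<bullet> g s))"
      using sum_integral_partition[of "\<lambda>s. f s \<bullet> g s" t N N] t N by simp
    then have "norm ((\<Sum>i<N. integral (?I i) f \<bullet> g (\<tau> N i)) - integral {0..t} (\<lambda>s. f s \<bullet> g s))
        = norm (\<Sum>i<N. (integral (?I i) f \<bullet> g (\<tau> N i) - integral (?I i) (\<lambda>s. f s \<bullet> g s)))"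
      by (simp add: sum_subtractf)
    also have "\<dots> \<le> (\<Sum>i<N. K * e' * (t / real N))"
      by (rule sum_norm_le) (use each in auto)
    also have "\<dots> = (K * e') * t"
      using N by simp
    also have "K * e' = e / (t + 1)"
      using K by (simp add: e'_def)
    also have "e / (t + 1) * t < e" using e t by (simp add: field_simps)
    finally show "norm ((\<Sum>i<N. integral (?I i) f \<bullet> g (\<tau> N i)) - integral {0..t} (\<lambda>s. f s \<bullet> g s)) < e" .
  qed
qed

lemma tendsto_left_endpoint_sums:
  fixes g :: "real \<Rightarrow> real"
  assumes g: "continuous_on {0..t} g" and t: "0 \<le> t"
  shows "(\<lambda>N. \<Sum>i<N. g (t * real i / real N) * (t * real (Suc i) / real N - t * real i / real N))
           \<longlonglongrightarrow> integral {0..t} g"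
proof -
  have "(\<lambda>N. \<Sum>i<N. integral {t * real i / real N..t * real (Suc i) / real N} (\<lambda>_. 1) \<bullet> g (t * real i / real N))
      \<longlonglongrightarrow> integral {0..t} (\<lambda>s. 1 \<bullet> g s)"
    by (rule tendsto_partition_sums) (use g t partition_bounds(2)[OF t] in auto)
  moreover have "(\<Sum>i<N. integral {t * real i / real N..t * real (Suc i) / real N} (\<lambda>_. 1) \<bullet> g (t * real i / real N))
     = (\<Sum>i<N. g (t * real i / real N) * (t * real (Suc i) / real N - t * real i / real N))" for N
    using partition_bounds(2)[OF t] by (intro sum.cong) (auto simp: mult.commute)
  ultimately show ?thesis by simp
qed

lemma sum_by_parts_inner:
  fixes r W :: "nat \<Rightarrow> 'a::real_inner"
  shows "(\<Sum>i<n. r i \<bullet> (W (Suc i) - W i)) = r n \<bullet> W n - r 0 \<bullet> W 0 - (\<Sum>i<n. (r (Suc i) - r i) \<bullet> W (Suc i))"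
  by (induction n) (simp_all add: inner_diff_left inner_diff_right)

text \<open>The left-point sums of a smooth integrand against a merely continuous path converge,
  because summation by parts moves the increment onto the integrand.\<close>

lemma tendsto_left_point_sums:
  fixes r r' W :: "real \<Rightarrow> 'a::euclidean_space"
  assumes r: "\<And>s. s \<in> {0..t} \<Longrightarrow> (r has_vector_derivative r' s) (at s within {0..t})"
    and r': "continuous_on {0..t} r'" and W: "continuous_on {0..t} W" and W0: "W 0 = 0" and t: "0 \<le> t"
  shows "(\<lambda>N. \<Sum>i<N. r (t * real i / real N) \<bullet> (W (t * real (Suc i) / real N) - W (t * real i / real N)))
           \<longlonglongrightarrow> r t \<bullet> W t - integral {0..t} (\<lambda>s. r' s \<bullet> W s)"
proof -
  let ?I = "\<lambda>N i. {t * real i / real N..t * real (Suc i) / real N}"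
  have lim: "(\<lambda>N. \<Sum>i<N. integral (?I N i) r' \<bullet> W (t * real (Suc i) / real N))
      \<longlonglongrightarrow> integral {0..t} (\<lambda>s. r' s \<bullet> W s)"
    by (rule tendsto_partition_sums) (use r' W t partition_bounds(2)[OF t] in auto)
  have eq: "r t \<bullet> W t - (\<Sum>i<N. integral (?I N i) r' \<bullet> W (t * real (Suc i) / real N))
      = (\<Sum>i<N. r (t * real i / real N) \<bullet> (W (t * real (Suc i) / real N) - W (t * real i / real N)))"
    if N: "0 < N" for N
  proof -
    have "integral (?I N i) r' = r (t * real (Suc i) / real N) - r (t * real i / real N)" if "i < N" for i
    proof (rule integral_unique, rule fundamental_theorem_of_calculus)
      fix x assume "x \<in> ?I N i"
      then show "(r has_vector_derivative r' x) (at x within ?I N i)"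
        using partition_bounds[OF t that]
        by (intro has_vector_derivative_within_subset[OF r]) auto
    qed (use partition_bounds[OF t that] in auto)
    then show ?thesis
      using N W0 sum_by_parts_inner[of "\<lambda>i. r (t * real i / real N)" "\<lambda>i. W (t * real i / real N)" N] by simp
  qed
  have "(\<lambda>N. r t \<bullet> W t - (\<Sum>i<N. integral (?I N i) r' \<bullet> W (t * real (Suc i) / real N)))
      \<longlonglongrightarrow> r t \<bullet> W t - integral {0..t} (\<lambda>s. r' s \<bullet> W s)"
    by (intro tendsto_intros lim)
  then show ?thesis
    by (rule Lim_transform_eventually) (use eq in \<open>auto intro!: eventually_sequentiallyI[of 1]\<close>)
qed

section \<open>Pairing the state with the adjoint equation\<close>

lemma matrix_vector_mult_continuous_on [continuous_intros]:
  fixes A :: "real^'n::finite^'m::finite"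
  assumes "continuous_on S f"
  shows "continuous_on S (\<lambda>x. A *v f x)"
  using assms by (intro bounded_linear.continuous_on[OF matrix_vector_mul_bounded_linear])

lemma inner_transpose: "(transpose M *v p) \<bullet> q = p \<bullet> (M *v (q :: real^'n::finite))"
  by (simp add: dot_lmul_matrix transpose_matrix_vector)

text \<open>\<open>x\<close> is no smoother than \<open>W\<close>, but \<open>y = x - R W\<close>
  differs from an integral of \<open>A x\<close> by a constant and is therefore differentiable. In
  the derivative of \<open>a \<bullet> y\<close> the two terms containing \<open>x\<close> cancel
  because \<open>a\<close> solves the adjoint equation, and a term in \<open>W\<close> is left. The
  right-hand side is the Wiener integral of \<open>R\<^sup>T a\<close> after integration by parts, a
  form meaningful for every continuous path.\<close>

lemma variation_of_constants_pairing:
  fixes A :: "real^'l::finite^'l" and R :: "real^'k::finite^'l" and x a :: "real \<Rightarrow> real^'l"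
    and W :: "real \<Rightarrow> real^'k"
  assumes x: "continuous_on {0..t} x" and W: "continuous_on {0..t} W" and t: "0 \<le> t"
    and sol: "\<And>s. s \<in> {0..t} \<Longrightarrow> x s = x 0 + integral {0..s} (\<lambda>r. A *v x r) + R *v W s"
    and a: "\<And>s. s \<in> {0..t} \<Longrightarrow> (a has_vector_derivative - (transpose A *v a s)) (at s within {0..t})"
    and W0: "W 0 = 0"
  shows "a t \<bullet> x t - a 0 \<bullet> x 0 =
     (transpose R *v a t) \<bullet> W t - integral {0..t} (\<lambda>s. (transpose R *v (- (transpose A *v a s))) \<bullet> W s)"
proof -
  define y where "y s = x s - R *v W s" for s
  have Ax: "continuous_on {0..t} (\<lambda>s. A *v x s)" by (intro continuous_intros x)
  have "((\<lambda>s. integral {0..s} (\<lambda>r. A *v x r)) has_vector_derivative A *v x s) (at s within {0..t})"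
    if "s \<in> {0..t}" for s
    using integral_has_vector_derivative[OF Ax that] .
  then have deriv: "((\<lambda>s. x 0 + integral {0..s} (\<lambda>r. A *v x r)) has_vector_derivative 0 + A *v x s) (at s within {0..t})"
    if "s \<in> {0..t}" for s
    using that by (intro has_vector_derivative_add has_vector_derivative_const)
  have y: "(y has_vector_derivative A *v x s) (at s within {0..t})" if "s \<in> {0..t}" for s
  proof (rule has_vector_derivative_transform[OF that _ deriv[OF that, unfolded add_0_left]])
    show "y r = x 0 + integral {0..r} (\<lambda>r. A *v x r)" if "r \<in> {0..t}" for r
      unfolding y_def using sol[OF that] by (metis add_diff_cancel_right')
  qed
  have "((\<lambda>s. a s \<bullet> y s) has_vector_derivative
      - ((transpose R *v (- (transpose A *v a s))) \<bullet> W s)) (at s within {0..t})" if s: "s \<in> {0..t}" for s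
  proof -
    have "((\<lambda>s. a s \<bullet> y s) has_vector_derivative
        a s \<bullet> (A *v x s) + (- (transpose A *v a s)) \<bullet> y s) (at s within {0..t})"
      by (rule bounded_bilinear.has_vector_derivative[OF bounded_bilinear_inner a[OF s] y[OF s]])
    also have "a s \<bullet> (A *v x s) + (- (transpose A *v a s)) \<bullet> y s
        = - ((transpose R *v (- (transpose A *v a s))) \<bullet> W s)"
      by (simp add: y_def inner_transpose inner_diff_right matrix_vector_mult_diff_distrib
          del: transpose_matrix_vector)
    finally show ?thesis .
  qed
  then have "((\<lambda>s. - ((transpose R *v (- (transpose A *v a s))) \<bullet> W s)) has_integral a t \<bullet> y t - a 0 \<bullet> y 0) {0..t}"
    by (rule fundamental_theorem_of_calculus[OF t])
  then have "- integral {0..t} (\<lambda>s. (transpose R *v (- (transpose A *v a s))) \<bullet> W s) = a t \<bullet> y t - a 0 \<bullet> y 0"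
    by (simp only: integral_unique integral_neg[symmetric])
  then show ?thesis
    using W0 by (simp add: y_def inner_diff_right inner_transpose del: transpose_matrix_vector)
qed

section \<open>Second moments of linear stochastic systems\<close>

text \<open>With the integrand frozen at the left end of the coarse cell, which has index
  \<open>i div q\<close>, each coarse increment telescopes into \<open>q\<close> fine ones. Sums on
  both grids then share their increments, and their difference is again a step integral covered by
  the isometry.\<close>

lemma sum_refined_partition:
  fixes r :: "real \<Rightarrow> 'a::real_inner" and W :: "real \<Rightarrow> 'a"
  assumes "0 < N" "0 < q"
  shows "(\<Sum>j<N. r (t * real j / real N) \<bullet> (W (t * real (Suc j) / real N) - W (t * real j / real N)))
    = (\<Sum>i<N * q. r (t * real (i div q) / real N) \<bullet>
          (W (t * real (Suc i) / real (N * q)) - W (t * real i / real (N * q))))"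
proof -
  have pt: "t * real j / real N = t * real (j * q) / real (N * q)" for j
    using assms by simp
  have "(\<Sum>i = j * q..<j * q + q. r (t * real (i div q) / real N) \<bullet>
          (W (t * real (Suc i) / real (N * q)) - W (t * real i / real (N * q))))
      = r (t * real j / real N) \<bullet> (W (t * real (Suc j) / real N) - W (t * real j / real N))" for j
  proof -
    have "i div q = j" if "i \<in> {j * q..<j * q + q}" for i
      using that \<open>0 < q\<close> by (intro div_nat_eqI) (auto simp: mult.commute)
    then have "(\<Sum>i = j * q..<j * q + q. r (t * real (i div q) / real N) \<bullet>
          (W (t * real (Suc i) / real (N * q)) - W (t * real i / real (N * q))))
        = (\<Sum>i = j * q..<j * q + q. r (t * real j / real N) \<bullet>
          (W (t * real (Suc i) / real (N * q)) - W (t * real i / real (N * q))))"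
      by (intro sum.cong) auto
    also have "\<dots> = r (t * real j / real N) \<bullet>
        (\<Sum>i = j * q..<j * q + q. W (t * real (Suc i) / real (N * q)) - W (t * real i / real (N * q)))"
      by (simp add: inner_sum_right)
    also have "(\<Sum>i = j * q..<j * q + q. W (t * real (Suc i) / real (N * q)) - W (t * real i / real (N * q)))
        = W (t * real (j * q + q) / real (N * q)) - W (t * real (j * q) / real (N * q))"
      by (rule sum_Suc_diff') simp
    finally show ?thesis
      by (simp only: pt[of j] pt[of "Suc j"] mult_Suc add.commute[of q])
  qed
  then show ?thesis
    by (simp only: sum.nat_group[symmetric])
qed

text \<open>\<open>S N\<close> approximates \<open>Z\<close> in L2 with error of order 1/N and is
  orthogonal to \<open>Y\<close>, so the second moment of \<open>Y + Z\<close> minus that of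
  \<open>Y\<close> differs from \<open>v N\<close> by a null sequence; uniqueness of limits
  identifies it with \<open>v'\<close>. For \<open>N = 0\<close> the bound would read
  \<open>K / 0 = 0\<close>, hence the restriction to positive \<open>N\<close>.\<close>

lemma (in prob_space) second_moment_of_L2_limit:
  fixes S :: "nat \<Rightarrow> 'a \<Rightarrow> real"
  assumes [measurable]: "Z \<in> borel_measurable M" "Y \<in> borel_measurable M" "\<And>N. S N \<in> borel_measurable M"
    and Y: "integrable M (\<lambda>w. (Y w)\<^sup>2)"
    and S: "\<And>N. 0 < N \<Longrightarrow> has_bochner_integral M (\<lambda>w. (S N w)\<^sup>2) (v N)"
    and YS: "\<And>N. 0 < N \<Longrightarrow> has_bochner_integral M (\<lambda>w. Y w * S N w) 0"
    and D: "\<And>N. 0 < N \<Longrightarrow> integrable M (\<lambda>w. (Z w - S N w)\<^sup>2)"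
      "\<And>N. 0 < N \<Longrightarrow> (\<integral>w. (Z w - S N w)\<^sup>2 \<partial>M) \<le> K / (real N)\<^sup>2"
    and v: "v \<longlonglongrightarrow> v'"
  shows "has_bochner_integral M (\<lambda>w. (Y w + Z w)\<^sup>2) ((\<integral>w. (Y w)\<^sup>2 \<partial>M) + v')"
proof -
  have int: "integrable M (\<lambda>w. (Y w + Z w)\<^sup>2)"
  proof (rule Bochner_Integration.integrable_bound)
    show "integrable M (\<lambda>w. 3 * (Y w)\<^sup>2 + 3 * (S 1 w)\<^sup>2 + 3 * (Z w - S 1 w)\<^sup>2)"
      using Y S[of 1] D(1)[of 1]
      by (intro Bochner_Integration.integrable_add integrable_mult_right) (auto simp: has_bochner_integral_iff)
    \<comment> \<open>\<open>a + c\<close> is the sum of \<open>a\<close>, \<open>b\<close> and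
      \<open>c - b\<close>; the squares of the pairwise differences of these three account for the
      factor 3.\<close>
    have "(a + c)\<^sup>2 \<le> 3 * a\<^sup>2 + 3 * b\<^sup>2 + 3 * (c - b)\<^sup>2" for a b c :: real
      using zero_le_power2[of "a - b"] zero_le_power2[of "a - (c - b)"] zero_le_power2[of "b - (c - b)"]
      by (simp add: power2_eq_square algebra_simps)
    then show "AE w in M. norm ((Y w + Z w)\<^sup>2) \<le> norm (3 * (Y w)\<^sup>2 + 3 * (S 1 w)\<^sup>2 + 3 * (Z w - S 1 w)\<^sup>2)"
      by (intro AE_I2) (simp add: abs_of_nonneg)
  qed measurable
  let ?e = "\<integral>w. (Y w + Z w)\<^sup>2 \<partial>M" and ?y = "\<integral>w. (Y w)\<^sup>2 \<partial>M"
  let ?b = "\<lambda>N. K / (real N)\<^sup>2 + (v N + ?y) / real N + 2 * (K / real N)"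
  have bound: "\<bar>v N - (?e - ?y)\<bar> \<le> ?b N" if N: "0 < N" for N
  proof -
    let ?D = "\<lambda>w. Z w - S N w"
    have iS: "integrable M (\<lambda>w. (S N w)\<^sup>2)" and eS: "(\<integral>w. (S N w)\<^sup>2 \<partial>M) = v N"
      and iYS: "integrable M (\<lambda>w. Y w * S N w)" and eYS: "(\<integral>w. Y w * S N w \<partial>M) = 0"
      using S[OF N] YS[OF N] by (auto simp: has_bochner_integral_iff)
    note ints = int Y iS iYS D(1)[OF N]
    have "?e - ?y - v N = (\<integral>w. (Y w + Z w)\<^sup>2 - (Y w)\<^sup>2 - (S N w)\<^sup>2 - 2 * (Y w * S N w) \<partial>M)"
      using ints eS eYS by simp
    also have "\<bar>\<dots>\<bar> \<le> (\<integral>w. \<bar>(Y w + Z w)\<^sup>2 - (Y w)\<^sup>2 - (S N w)\<^sup>2 - 2 * (Y w * S N w)\<bar> \<partial>M)"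
      by (rule integral_abs_bound)
    also have "\<dots> \<le> (\<integral>w. (?D w)\<^sup>2 + ((S N w)\<^sup>2 + (Y w)\<^sup>2) / real N + 2 * real N * (?D w)\<^sup>2 \<partial>M)"
    proof (rule integral_mono)
      fix w
      \<comment> \<open>The weight \<open>N\<close> balances the cross terms: the second moments of
        \<open>S N\<close> and \<open>Y\<close> are divided by \<open>N\<close>, while the squared
        error, of order 1/N^2, is multiplied by \<open>N\<close> only.\<close>
      have young: "2 * \<bar>a * c\<bar> \<le> a\<^sup>2 / real N + real N * c\<^sup>2" for a c :: real
      proof -
        have "0 \<le> (\<bar>a\<bar> / sqrt (real N) - sqrt (real N) * \<bar>c\<bar>)\<^sup>2" by simp
        also have "\<dots> = a\<^sup>2 / real N + real N * c\<^sup>2 - 2 * \<bar>a * c\<bar>"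
          using N by (simp add: power2_diff power_divide power_mult_distrib abs_mult)
        finally show ?thesis by simp
      qed
      have "(Y w + Z w)\<^sup>2 - (Y w)\<^sup>2 - (S N w)\<^sup>2 - 2 * (Y w * S N w)
          = (?D w)\<^sup>2 + 2 * (S N w * ?D w) + 2 * (Y w * ?D w)"
        by (simp add: power2_eq_square algebra_simps)
      also have "\<bar>\<dots>\<bar> \<le> (?D w)\<^sup>2 + 2 * \<bar>S N w * ?D w\<bar> + 2 * \<bar>Y w * ?D w\<bar>"
        using zero_le_power2[of "?D w"] by linarith
      also have "\<dots> \<le> (?D w)\<^sup>2 + ((S N w)\<^sup>2 + (Y w)\<^sup>2) / real N + 2 * real N * (?D w)\<^sup>2"
        using young[of "S N w" "?D w"] young[of "Y w" "?D w"] by (simp add: add_divide_distrib)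
      finally show "\<bar>(Y w + Z w)\<^sup>2 - (Y w)\<^sup>2 - (S N w)\<^sup>2 - 2 * (Y w * S N w)\<bar>
          \<le> (?D w)\<^sup>2 + ((S N w)\<^sup>2 + (Y w)\<^sup>2) / real N + 2 * real N * (?D w)\<^sup>2" .
    qed (use ints in auto)
    also have "\<dots> = (\<integral>w. (?D w)\<^sup>2 \<partial>M) + (v N + ?y) / real N + 2 * real N * (\<integral>w. (?D w)\<^sup>2 \<partial>M)"
      using ints eS by simp
    also have "\<dots> \<le> K / (real N)\<^sup>2 + (v N + ?y) / real N + 2 * real N * (K / (real N)\<^sup>2)"
      using D(2)[OF N] N by (intro add_mono mult_left_mono) auto
    also have "\<dots> = ?b N"
      using N by (simp add: power2_eq_square)
    finally show ?thesis by simp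
  qed
  have "(\<lambda>N. K / (real N)\<^sup>2) \<longlonglongrightarrow> 0" "(\<lambda>N. K / real N) \<longlonglongrightarrow> 0"
    by real_asymp real_asymp
  moreover have "(\<lambda>N. (v N + ?y) / real N) \<longlonglongrightarrow> 0"
    using tendsto_mult[OF tendsto_add[OF v tendsto_const[of ?y]] lim_inverse_n] by (simp add: divide_inverse)
  ultimately have "?b \<longlonglongrightarrow> 0 + 0 + 2 * 0"
    by (intro tendsto_add tendsto_mult tendsto_const)
  then have b0: "?b \<longlonglongrightarrow> 0" by simp
  have "(\<lambda>N. v N - (?e - ?y)) \<longlonglongrightarrow> 0"
  proof (rule Lim_null_comparison[OF _ b0])
    show "\<forall>\<^sub>F N in sequentially. norm (v N - (?e - ?y)) \<le> ?b N"
      using bound by (intro eventually_sequentiallyI[of 1]) (simp only: real_norm_def)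
  qed
  then have "v \<longlonglongrightarrow> ?e - ?y" by (rule LIM_zero_cancel)
  then have "v' = ?e - ?y" by (rule LIMSEQ_unique[OF v])
  then show ?thesis using int by (simp add: has_bochner_integral_iff)
qed

lemma vector_derivative_lipschitz:
  fixes r :: "real \<Rightarrow> 'a::euclidean_space"
  assumes r: "\<And>s. s \<in> {0..t} \<Longrightarrow> (r has_vector_derivative r' s) (at s within {0..t})"
    and r': "continuous_on {0..t} r'"
  obtains K where "0 \<le> K" "\<And>x y. 0 \<le> x \<Longrightarrow> x \<le> y \<Longrightarrow> y \<le> t \<Longrightarrow> norm (r y - r x) \<le> K * (y - x)"
proof -
  obtain K where K: "0 < K" "\<And>s. s \<in> {0..t} \<Longrightarrow> norm (r' s) \<le> K"
    using compact_continuous_image[OF r'] bounded_pos[of "r' ` {0..t}"] compact_imp_bounded by auto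
  have "norm (r y - r x) \<le> K * (y - x)" if xy: "0 \<le> x" "x \<le> y" "y \<le> t" for x y
  proof -
    have sub: "{x..y} \<subseteq> {0..t}" using xy by auto
    have "(r' has_integral r y - r x) {x..y}"
      using xy by (intro fundamental_theorem_of_calculus has_vector_derivative_within_subset[OF r sub]) auto
    then have "r y - r x = integral {x..y} r'" by (simp add: integral_unique)
    also have "norm \<dots> \<le> K * (y - x)"
      using sub by (intro integral_bound xy continuous_on_subset[OF r'] K) auto
    finally show ?thesis .
  qed
  then show thesis using that[of K] K by auto
qed

lemma (in prob_space) square_integrable_inner:
  fixes Z :: "'a \<Rightarrow> real^'l::finite"
  assumes [measurable]: "Z \<in> borel_measurable M" and Z: "integrable M (\<lambda>w. (norm (Z w))\<^sup>2)"
  shows "integrable M (\<lambda>w. (p \<bullet> Z w)\<^sup>2)"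
    and "(\<integral>w. (p \<bullet> Z w)\<^sup>2 \<partial>M) \<le> (norm p)\<^sup>2 * (\<integral>w. (norm (Z w))\<^sup>2 \<partial>M)"
proof -
  have le: "(p \<bullet> Z w)\<^sup>2 \<le> (norm p)\<^sup>2 * (norm (Z w))\<^sup>2" for w
    using power_mono[OF Cauchy_Schwarz_ineq2 abs_ge_zero, of p "Z w" 2]
    by (simp add: power_mult_distrib)
  show int: "integrable M (\<lambda>w. (p \<bullet> Z w)\<^sup>2)"
  proof (rule Bochner_Integration.integrable_bound)
    show "integrable M (\<lambda>w. (norm p)\<^sup>2 * (norm (Z w))\<^sup>2)" using Z by simp
    show "AE w in M. norm ((p \<bullet> Z w)\<^sup>2) \<le> norm ((norm p)\<^sup>2 * (norm (Z w))\<^sup>2)"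
      using le by (intro AE_I2) simp
  qed measurable
  have "(\<integral>w. (p \<bullet> Z w)\<^sup>2 \<partial>M) \<le> (\<integral>w. (norm p)\<^sup>2 * (norm (Z w))\<^sup>2 \<partial>M)"
    using int Z le by (intro integral_mono) auto
  then show "(\<integral>w. (p \<bullet> Z w)\<^sup>2 \<partial>M) \<le> (norm p)\<^sup>2 * (\<integral>w. (norm (Z w))\<^sup>2 \<partial>M)" by simp
qed

text \<open>With \<open>a\<close> a solution of the adjoint equation, \<open>a(t) \<bullet> X(t) - a(0) \<bullet> X(0)\<close> is the Wiener
  integral of \<open>R\<^sup>T a\<close>: pathwise it is the limit of left-point sums, whose second moments obey the
  Ito isometry trivially. Comparing the sums with their refinements turns the pathwise limit into
  an \<open>L\<^sup>2\<close> limit by Fatou's lemma.\<close>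

lemma (in prob_space) linear_sde_functional_second_moment:
  fixes A :: "real^'l::finite^'l" and R :: "real^'k::finite^'l" and a :: "real \<Rightarrow> real^'l"
    and W :: "real \<Rightarrow> 'a \<Rightarrow> real^'k" and X :: "real \<Rightarrow> 'a \<Rightarrow> real^'l"
  assumes W: "wiener_process M W" and sol: "linear_sde_solution M A R W X"
    and ind: "independent_of_process M (X 0) W"
    and X0: "integrable M (\<lambda>w. (norm (X 0 w))\<^sup>2)" and t: "0 < t"
    and a: "\<And>s. s \<in> {0..t} \<Longrightarrow> (a has_vector_derivative - (transpose A *v a s)) (at s within {0..t})"
  shows "has_bochner_integral M (\<lambda>w. (a t \<bullet> X t w)\<^sup>2)
     ((\<integral>w. (a 0 \<bullet> X 0 w)\<^sup>2 \<partial>M) + integral {0..t} (\<lambda>s. (norm (transpose R *v a s))\<^sup>2))"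
proof -
  define r where "r s = transpose R *v a s" for s
  define r' where "r' s = transpose R *v (- (transpose A *v a s))" for s
  define S where "S N w = (\<Sum>i<N. r (t * real i / real N) \<bullet>
      (W (t * real (Suc i) / real N) w - W (t * real i / real N) w))" for N w
  define Z where "Z w = a t \<bullet> X t w - a 0 \<bullet> X 0 w" for w
  have mW: "W s \<in> borel_measurable M" and mX[measurable]: "X s \<in> borel_measurable M" if "0 \<le> s" for s
    using W sol that by (auto simp: wiener_process_def linear_sde_solution_def)
  have [measurable]: "X 0 \<in> borel_measurable M" "X t \<in> borel_measurable M" using mX t by auto
  have mS[measurable]: "S N \<in> borel_measurable M" for N
    unfolding S_def using t
    by (intro borel_measurable_sum borel_measurable_inner borel_measurable_const borel_measurable_diff mW) auto
  have mZ[measurable]: "Z \<in> borel_measurable M" unfolding Z_def by measurable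
  have ca: "continuous_on {0..t} a"
    using a by (rule continuous_on_vector_derivative)
  have r: "(r has_vector_derivative r' s) (at s within {0..t})" if "s \<in> {0..t}" for s
    unfolding r_def r'_def
    using bounded_linear.has_vector_derivative[OF matrix_vector_mul_bounded_linear a[OF that]] .
  have cr': "continuous_on {0..t} r'"
    unfolding r'_def by (intro continuous_intros ca)
  have cr: "continuous_on {0..t} r"
    unfolding r_def by (intro continuous_intros ca)
  \<comment> \<open>The adjoint pairing and the limit of the left-point sums give the same
    expression: the boundary term \<open>r t \<bullet> W t\<close> minus the integral of
    \<open>r' \<bullet> W\<close>.\<close>
  have path: "AE w in M. (\<lambda>N. S N w) \<longlonglongrightarrow> Z w"
  proof -
    have "AE w in M. W 0 w = 0 \<and> continuous_on {0..} (\<lambda>t. W t w)"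
      "AE w in M. continuous_on {0..} (\<lambda>t. X t w) \<and>
        (\<forall>t\<ge>0. X t w = X 0 w + integral {0..t} (\<lambda>s. A *v X s w) + R *v (W t w - W 0 w))"
      using W sol by (auto simp: wiener_process_def linear_sde_solution_def)
    then show ?thesis
    proof eventually_elim
      case (elim w)
      have sub: "{0..t} \<subseteq> {0..}" by auto
      have cW: "continuous_on {0..t} (\<lambda>s. W s w)" and cX: "continuous_on {0..t} (\<lambda>s. X s w)"
        using elim by (auto intro: continuous_on_subset[OF _ sub])
      have path_sol: "X s w = X 0 w + integral {0..s} (\<lambda>s. A *v X s w) + R *v W s w" if "s \<in> {0..t}" for s
      proof -
        have "X s w = X 0 w + integral {0..s} (\<lambda>s. A *v X s w) + R *v (W s w - W 0 w)"
          using elim(2) that by (elim conjE allE[of _ s]) auto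
        then show ?thesis using elim(1) by simp
      qed
      have "Z w = r t \<bullet> W t w - integral {0..t} (\<lambda>s. r' s \<bullet> W s w)"
        unfolding Z_def r_def r'_def
        using elim(1) t
        by (intro variation_of_constants_pairing[OF cX cW _ path_sol a]) auto
      then show ?case
        using tendsto_left_point_sums[OF r cr' cW] elim t by (simp add: S_def)
    qed
  qed
  obtain K where K: "0 \<le> K"
    "\<And>x y. 0 \<le> x \<Longrightarrow> x \<le> y \<Longrightarrow> y \<le> t \<Longrightarrow> norm (r y - r x) \<le> K * (y - x)"
    using vector_derivative_lipschitz[OF r cr'] by metis
  \<comment> \<open>On the fine grid the coefficient of each increment is the change of
    \<open>r\<close> since the left end of the coarse cell. Writing \<open>Suc q\<close> keeps the
    refinement factor positive.\<close>
  have refine: "has_bochner_integral M (\<lambda>w. (S (N * Suc q) w - S N w)\<^sup>2)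
      (\<Sum>i<N * Suc q. (norm (r (t * real i / real (N * Suc q)) - r (t * real (i div Suc q) / real N)))\<^sup>2 *
        (t * real (Suc i) / real (N * Suc q) - t * real i / real (N * Suc q)))" (is "has_bochner_integral M _ (?v N q)")
    if N: "0 < N" for N q
  proof -
    have "S (N * Suc q) w - S N w = (\<Sum>i<N * Suc q.
        (r (t * real i / real (N * Suc q)) - r (t * real (i div Suc q) / real N)) \<bullet>
        (W (t * real (Suc i) / real (N * Suc q)) w - W (t * real i / real (N * Suc q)) w))" for w
      unfolding S_def sum_refined_partition[OF N zero_less_Suc, of r t "\<lambda>s. W s w" q]
      by (simp only: sum_subtractf[symmetric] inner_diff_left)
    then show ?thesis
      using wiener_sum_second_moment[OF W, of "\<lambda>i. t * real i / real (N * Suc q)" "N * Suc q"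
          "\<lambda>i. r (t * real i / real (N * Suc q)) - r (t * real (i div Suc q) / real N)"] t N
      by (simp add: divide_strict_right_mono del: of_nat_Suc of_nat_mult mult_Suc_right)
  qed
  \<comment> \<open>Fine grid points lie within \<open>t / N\<close> of the left end of their coarse
    cell, so the Lipschitz bound makes each coefficient at most \<open>K * (t / N)\<close>, and the
    cell lengths add up to \<open>t\<close>. The result does not depend on \<open>q\<close>, as
    Fatou's lemma requires.\<close>
  have v_le: "?v N q \<le> K\<^sup>2 * t ^ 3 / (real N)\<^sup>2" if N: "0 < N" for N q
  proof -
    have "(norm (r (t * real i / real (N * Suc q)) - r (t * real (i div Suc q) / real N)))\<^sup>2 *
        (t * real (Suc i) / real (N * Suc q) - t * real i / real (N * Suc q))
      \<le> (K * (t / real N))\<^sup>2 * (t / real (N * Suc q))" if i: "i < N * Suc q" for i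
    proof -
      let ?x = "t * real (i div Suc q) / real N" and ?y = "t * real i / real (N * Suc q)"
      have x: "?x = t * real (i div Suc q * Suc q) / real (N * Suc q)"
        using N by (simp del: of_nat_Suc mult_Suc_right)
      have d: "i div Suc q * Suc q \<le> i" "i \<le> i div Suc q * Suc q + Suc q"
        using div_mult_mod_eq[of i "Suc q"] mod_less_divisor[of "Suc q" i] by linarith+
      have "?x \<le> ?y"
        unfolding x using t d(1) by (intro divide_right_mono mult_left_mono) (auto simp del: of_nat_mult)
      moreover have "?y \<le> ?x + t / real N"
      proof -
        have "t * real i \<le> t * real (i div Suc q * Suc q + Suc q)"
          using t d(2) by (intro mult_left_mono) (auto simp del: of_nat_mult of_nat_add)
        then have "?y \<le> t * real (i div Suc q * Suc q + Suc q) / real (N * Suc q)"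
          by (intro divide_right_mono) auto
        also have "\<dots> = (t * real (i div Suc q * Suc q) + t * real (Suc q)) / real (N * Suc q)"
          by (simp only: of_nat_add distrib_left)
        also have "\<dots> = ?x + t / real N"
          unfolding x using N by (simp add: add_divide_distrib del: of_nat_Suc mult_Suc_right)
        finally show ?thesis .
      qed
      moreover have "0 \<le> ?x" "?y \<le> t"
        using t i N by (auto simp: divide_le_eq simp del: of_nat_mult of_nat_Suc intro!: mult_left_mono)
      ultimately have "norm (r ?y - r ?x) \<le> K * (t / real N)"
        using K(2)[of ?x ?y] mult_left_mono[of "?y - ?x" "t / real N" K] K(1) by linarith
      then have "(norm (r ?y - r ?x))\<^sup>2 \<le> (K * (t / real N))\<^sup>2"
        by (intro power_mono) auto
      then show ?thesis
        using partition_bounds(4)[OF _ i] t by (intro mult_mono) (auto simp del: of_nat_mult of_nat_Suc mult_Suc_right)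
    qed
    then have "?v N q \<le> (\<Sum>i<N * Suc q. (K * (t / real N))\<^sup>2 * (t / real (N * Suc q)))"
      by (intro sum_mono) auto
    also have "\<dots> = K\<^sup>2 * t ^ 3 / (real N)\<^sup>2"
      using N by (simp add: power_mult_distrib power_divide power2_eq_square power3_eq_cube
          del: of_nat_Suc mult_Suc_right)
    finally show ?thesis .
  qed
  have L2: "integrable M (\<lambda>w. (Z w - S N w)\<^sup>2)" "(\<integral>w. (Z w - S N w)\<^sup>2 \<partial>M) \<le> K\<^sup>2 * t ^ 3 / (real N)\<^sup>2"
    if N: "0 < N" for N
  proof -
    \<comment> \<open>For fixed \<open>N\<close> the refinements run through a subsequence of all
      grids, so they inherit the pathwise limit.\<close>
    have sub: "filterlim (\<lambda>q. N * Suc q) at_top sequentially"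
      using N by (intro filterlim_subseq strict_monoI) auto
    have lim: "AE w in M. (\<lambda>q. S (N * Suc q) w - S N w) \<longlonglongrightarrow> Z w - S N w"
      using path
    proof eventually_elim
      case (elim w)
      show ?case by (intro tendsto_intros filterlim_compose[OF elim sub])
    qed
    have int: "integrable M (\<lambda>w. (S (N * Suc q) w - S N w)\<^sup>2)"
      and le: "(\<integral>w. (S (N * Suc q) w - S N w)\<^sup>2 \<partial>M) \<le> K\<^sup>2 * t ^ 3 / (real N)\<^sup>2" for q
      using refine[OF N, of q] v_le[OF N, of q] by (auto simp: has_bochner_integral_iff simp del: mult_Suc_right)
    show "integrable M (\<lambda>w. (Z w - S N w)\<^sup>2)" "(\<integral>w. (Z w - S N w)\<^sup>2 \<partial>M) \<le> K\<^sup>2 * t ^ 3 / (real N)\<^sup>2"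
      by (rule square_integrable_AE_limit[OF _ _ lim int le]; measurable)+
  qed
  have iX0: "integrable M (\<lambda>w. (p \<bullet> X 0 w)\<^sup>2)" for p
    by (rule square_integrable_inner(1)[OF _ X0]) measurable
  have iX0': "integrable M (\<lambda>w. a 0 \<bullet> X 0 w)"
    by (rule square_integrable_imp_integrable[OF _ iX0]) measurable
  \<comment> \<open>Every increment is centred and independent of \<open>X 0\<close>, so the product
    of the means vanishes whatever the mean of \<open>X 0\<close> is.\<close>
  have cross: "has_bochner_integral M (\<lambda>w. (a 0 \<bullet> X 0 w) * S N w) 0" if N: "0 < N" for N
  proof -
    have "has_bochner_integral M (\<lambda>w. (a 0 \<bullet> X 0 w) * (r (t * real i / real N) \<bullet>
      (W (t * real (Suc i) / real N) w - W (t * real i / real N) w))) 0" if "i < N" for i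
    proof -
      have st: "0 \<le> t * real i / real N" "t * real i / real N < t * real (Suc i) / real N"
        using t N by (auto simp: divide_strict_right_mono)
      have m: "has_bochner_integral M (\<lambda>w. r (t * real i / real N) \<bullet>
          (W (t * real (Suc i) / real N) w - W (t * real i / real N) w)) 0"
        by (rule wiener_increment_moments(1)[OF W st])
      have iv: "indep_var borel (\<lambda>w. a 0 \<bullet> X 0 w) borel (\<lambda>w. r (t * real i / real N) \<bullet>
          (W (t * real (Suc i) / real N) w - W (t * real i / real N) w))"
        by (rule independent_of_process_increment[OF W ind]) (use st in auto)
      show ?thesis
        using indep_var_lebesgue_integral[OF iv iX0'] indep_var_integrable[OF iv iX0'] m
        by (simp add: has_bochner_integral_iff)
    qed
    then have "has_bochner_integral M (\<lambda>w. \<Sum>i<N. (a 0 \<bullet> X 0 w) * (r (t * real i / real N) \<bullet>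
      (W (t * real (Suc i) / real N) w - W (t * real i / real N) w))) (\<Sum>i<N. 0)"
      by (intro has_bochner_integral_sum) auto
    then show ?thesis by (simp add: S_def sum_distrib_left)
  qed
  have "has_bochner_integral M (\<lambda>w. (a 0 \<bullet> X 0 w + Z w)\<^sup>2)
     ((\<integral>w. (a 0 \<bullet> X 0 w)\<^sup>2 \<partial>M) + integral {0..t} (\<lambda>s. (norm (r s))\<^sup>2))"
  proof (rule second_moment_of_L2_limit[OF mZ _ mS iX0 _ cross L2])
    show "has_bochner_integral M (\<lambda>w. (S N w)\<^sup>2) (\<Sum>i<N. (norm (r (t * real i / real N)))\<^sup>2 *
        (t * real (Suc i) / real N - t * real i / real N))" if "0 < N" for N
      unfolding S_def using t that
      by (intro wiener_sum_second_moment[OF W]) (auto simp: divide_strict_right_mono)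
    show "(\<lambda>N. \<Sum>i<N. (norm (r (t * real i / real N)))\<^sup>2 *
        (t * real (Suc i) / real N - t * real i / real N)) \<longlonglongrightarrow> integral {0..t} (\<lambda>s. (norm (r s))\<^sup>2)"
      using t by (intro tendsto_left_endpoint_sums[of t "\<lambda>s. (norm (r s))\<^sup>2"] continuous_intros cr) auto
  qed (auto)
  then show ?thesis by (simp add: Z_def r_def)
qed

section \<open>The damped oscillator\<close>

text \<open>The solutions of f'' = D f with initial data (1, 0) and (0, 1). In the application
  \<open>D = p\<^sup>2 / 4 - q\<close>, and its three signs are the underdamped, critical and
  overdamped regimes.\<close>

lemma second_order_fundamental_system:
  fixes D :: real
  obtains C S :: "real \<Rightarrow> real" where "C 0 = 1" "S 0 = 0"
    "\<And>s. (C has_real_derivative D * S s) (at s)" "\<And>s. (S has_real_derivative C s) (at s)"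
proof (cases D "0::real" rule: linorder_cases)
  case less
  define k where "k = sqrt (- D)"
  have k: "k \<noteq> 0" "D = - (k * k)" using less by (auto simp: k_def)
  show ?thesis
    by (rule that[of "\<lambda>s. cos (k * s)" "\<lambda>s. sin (k * s) / k"])
       (use k in \<open>auto intro!: derivative_eq_intros\<close>)
next
  case equal
  show ?thesis
    by (rule that[of "\<lambda>_. 1" "\<lambda>s. s"]) (use equal in \<open>auto intro!: derivative_eq_intros\<close>)
next
  case greater
  define k where "k = sqrt D"
  have k: "k \<noteq> 0" "D = k * k" using greater by (auto simp: k_def)
  show ?thesis
    by (rule that[of "\<lambda>s. cosh (k * s)" "\<lambda>s. sinh (k * s) / k"])
       (use k in \<open>auto intro!: derivative_eq_intros\<close>)
qed

text \<open>The substitution \<open>\<beta> = exp (- p s / 2) f\<close> removes the damping term, leaving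
  \<open>f'' = (p\<^sup>2 / 4 - q) f\<close>.\<close>

lemma damped_oscillator_solution:
  fixes p q \<alpha>0 \<beta>0 :: real
  obtains \<alpha> \<beta> :: "real \<Rightarrow> real" where "\<alpha> 0 = \<alpha>0" "\<beta> 0 = \<beta>0"
    "\<And>s. (\<alpha> has_real_derivative - q * \<beta> s) (at s)"
    "\<And>s. (\<beta> has_real_derivative \<alpha> s - p * \<beta> s) (at s)"
proof -
  obtain C S :: "real \<Rightarrow> real" where CS: "C 0 = 1" "S 0 = 0"
    "\<And>s. (C has_real_derivative (p\<^sup>2 / 4 - q) * S s) (at s)" "\<And>s. (S has_real_derivative C s) (at s)"
    using second_order_fundamental_system[of "p\<^sup>2 / 4 - q"] by blast
  \<comment> \<open>\<open>c\<close> is the initial slope \<open>f' 0\<close>. The first component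
    has to be \<beta>' + p \<beta>, whose value at 0 is \<open>f' 0 + p / 2 * f 0\<close>, and this
    choice makes it \<open>\<alpha>0\<close>.\<close>
  define c where "c = \<alpha>0 - p / 2 * \<beta>0"
  define f where "f s = \<beta>0 * C s + c * S s" for s
  define f' where "f' s = \<beta>0 * ((p\<^sup>2 / 4 - q) * S s) + c * C s" for s
  have f: "(f has_real_derivative f' s) (at s)" for s
    unfolding f_def[abs_def] f'_def by (auto intro!: derivative_eq_intros CS)
  have f': "(f' has_real_derivative (p\<^sup>2 / 4 - q) * f s) (at s)" for s
    unfolding f_def f'_def[abs_def] by (auto intro!: derivative_eq_intros CS simp: algebra_simps)
  show ?thesis
  proof (rule that[of "\<lambda>s. exp (- p / 2 * s) * (f' s + p / 2 * f s)" "\<lambda>s. exp (- p / 2 * s) * f s"])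
    show "((\<lambda>s. exp (- p / 2 * s) * (f' s + p / 2 * f s)) has_real_derivative
        - q * (exp (- p / 2 * s) * f s)) (at s)" for s
      by (auto intro!: derivative_eq_intros f f' simp: field_simps power2_eq_square)
    show "((\<lambda>s. exp (- p / 2 * s) * f s) has_real_derivative
        exp (- p / 2 * s) * (f' s + p / 2 * f s) - p * (exp (- p / 2 * s) * f s)) (at s)" for s
      by (auto intro!: derivative_eq_intros f f' simp: algebra_simps)
  qed (auto simp: f_def f'_def CS c_def)
qed

section \<open>Decay of the damped oscillator\<close>

lemma tendsto_exponential_decay:
  fixes c k :: real
  assumes "0 < c"
  shows "((\<lambda>s. k * exp (- c * s)) \<longlongrightarrow> 0) at_top"
proof -
  have "filterlim (\<lambda>s. c * s) at_top at_top"
    using assms by (intro filterlim_tendsto_pos_mult_at_top[OF tendsto_const]) (auto simp: filterlim_ident)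
  then have "filterlim (\<lambda>s. - (c * s)) at_bot at_top"
    by (simp add: filterlim_uminus_at_top)
  then have "((\<lambda>s. exp (- (c * s))) \<longlongrightarrow> 0) at_top"
    by (rule filterlim_compose[OF exp_at_bot])
  then show ?thesis using tendsto_mult_right_zero by fastforce
qed

text \<open>Gronwall's argument: the differential inequality makes \<open>U s * exp (c * s)\<close>
  nonincreasing.\<close>

lemma tendsto_zero_of_exponential_decay:
  fixes U U' :: "real \<Rightarrow> real"
  assumes U: "\<And>s. (U has_real_derivative U' s) (at s)" and nonneg: "\<And>s. 0 \<le> U s"
    and decay: "\<And>s. U' s \<le> - c * U s" and c: "0 < c"
  shows "(U \<longlongrightarrow> 0) at_top"
proof (rule tendsto_sandwich[OF _ _ tendsto_const])
  show "\<forall>\<^sub>F s in at_top. U s \<le> U 0 * exp (- c * s)"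
    using eventually_ge_at_top[of 0]
  proof eventually_elim
    case (elim s)
    have "U s * exp (c * s) \<le> U 0 * exp (c * 0)"
    proof (rule DERIV_nonpos_imp_nonincreasing[OF elim])
      fix x
      have "((\<lambda>s. U s * exp (c * s)) has_real_derivative (U' x + c * U x) * exp (c * x)) (at x)"
        by (auto intro!: derivative_eq_intros U simp: algebra_simps)
      then show "\<exists>y. ((\<lambda>s. U s * exp (c * s)) has_real_derivative y) (at x) \<and> y \<le> 0"
        using decay[of x] by (intro exI conjI) (auto intro!: mult_nonpos_nonneg)
    qed
    then show ?case by (simp add: exp_minus field_simps)
  qed
  show "((\<lambda>s. U 0 * exp (- c * s)) \<longlongrightarrow> 0) at_top"
    by (rule tendsto_exponential_decay[OF c])
  show "\<forall>\<^sub>F s in at_top. 0 \<le> U s" using nonneg by simp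
qed

text \<open>The energy \<open>\<alpha>\<^sup>2 + q \<beta>\<^sup>2\<close> is dissipated only through \<open>\<beta>\<close>; the cross term in the Lyapunov
  function makes the decay strict.\<close>

lemma damped_oscillator_decay:
  fixes p q :: real
  assumes \<alpha>: "\<And>s. (\<alpha> has_real_derivative - q * \<beta> s) (at s)"
    and \<beta>: "\<And>s. (\<beta> has_real_derivative \<alpha> s - p * \<beta> s) (at s)"
    and p: "0 < p" and q: "0 < q"
  shows "(\<alpha> \<longlongrightarrow> 0) at_top" "(\<beta> \<longlongrightarrow> 0) at_top"
proof -
  \<comment> \<open>The first bound lets the damping of \<beta> pay for the terms that the cross
    term adds to \<open>U'\<close>; the second gives \<open>4 * e\<^sup>2 \<le> q\<close>, which
    keeps the cross term below half the energy, so that \<open>U\<close> stays comparable to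
    it.\<close>
  define e where "e = min (p * q / (2 * q + p\<^sup>2)) (sqrt q / 2)"
  have den: "0 < 2 * q + p\<^sup>2" using p q by (simp add: add_pos_pos)
  have e: "0 < e" using p q den by (simp add: e_def)
  have "e \<le> p * q / (2 * q + p\<^sup>2)" by (simp add: e_def)
  then have e1: "e * (2 * q + p\<^sup>2) \<le> p * q" using den by (simp add: le_divide_eq)
  have "e * (2 * q) \<le> e * (2 * q + p\<^sup>2)" using e by (intro mult_left_mono) auto
  then have "2 * e * q \<le> p * q" using e1 by simp
  then have ep: "e \<le> p" using q e by simp
  have "e \<le> sqrt q / 2" unfolding e_def by (rule min.cobounded2)
  then have "e\<^sup>2 \<le> (sqrt q / 2)\<^sup>2" using e by (intro power_mono) auto
  then have e2: "4 * e\<^sup>2 \<le> q" using q by (simp add: power_divide)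
  define U where "U s = (\<alpha> s)\<^sup>2 + q * (\<beta> s)\<^sup>2 - 2 * e * (\<alpha> s * \<beta> s)" for s
  define U' where "U' s = - 2 * p * q * (\<beta> s)\<^sup>2 - 2 * e * ((\<alpha> s)\<^sup>2 - q * (\<beta> s)\<^sup>2 - p * (\<alpha> s * \<beta> s))" for s
  have dU: "(U has_real_derivative U' s) (at s)" for s
    unfolding U_def[abs_def] U'_def
    by (auto intro!: derivative_eq_intros \<alpha> \<beta> simp: algebra_simps power2_eq_square)
  have cross: "\<bar>2 * e * (\<alpha> s * \<beta> s)\<bar> \<le> ((\<alpha> s)\<^sup>2 + q * (\<beta> s)\<^sup>2) / 2" for s
  proof -
    have "0 \<le> (\<bar>\<alpha> s\<bar> - 2 * e * \<bar>\<beta> s\<bar>)\<^sup>2" by simp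
    then have "2 * (2 * e * \<bar>\<alpha> s * \<beta> s\<bar>) \<le> (\<alpha> s)\<^sup>2 + 4 * e\<^sup>2 * (\<beta> s)\<^sup>2"
      by (simp add: power2_diff power_mult_distrib abs_mult algebra_simps)
    also have "\<dots> \<le> (\<alpha> s)\<^sup>2 + q * (\<beta> s)\<^sup>2" using e2 by (intro add_mono mult_right_mono) auto
    finally show ?thesis using e by (simp add: abs_mult)
  qed
  have U_lower: "(\<alpha> s)\<^sup>2 + q * (\<beta> s)\<^sup>2 \<le> 2 * U s" and U_upper: "U s \<le> 3 / 2 * ((\<alpha> s)\<^sup>2 + q * (\<beta> s)\<^sup>2)" for s
    using cross[of s] by (auto simp: U_def abs_le_iff field_simps)
  have energy_nonneg: "0 \<le> (\<alpha> s)\<^sup>2 + q * (\<beta> s)\<^sup>2" for s using q by simp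
  \<comment> \<open>Completing the square bounds the mixed term. Of the two copies of
    \<open>p * q * \<beta>\<^sup>2\<close> in \<open>U'\<close>, one absorbs
    \<open>e * (2 * q + p\<^sup>2) * \<beta>\<^sup>2\<close> and the other leaves at least
    \<open>e * q * \<beta>\<^sup>2\<close>. The rate is \<open>2 / 3 * e\<close> because
    \<open>U\<close> is at most 3/2 times the energy.\<close>
  have "U' s \<le> - (2 / 3 * e) * U s" for s
  proof -
    have "0 \<le> e * (\<alpha> s - p * \<beta> s)\<^sup>2" using e by simp
    then have "2 * e * p * (\<alpha> s * \<beta> s) \<le> e * (\<alpha> s)\<^sup>2 + e * p\<^sup>2 * (\<beta> s)\<^sup>2"
      by (simp add: power2_diff power_mult_distrib algebra_simps)
    moreover have "e * (2 * q + p\<^sup>2) * (\<beta> s)\<^sup>2 \<le> p * q * (\<beta> s)\<^sup>2"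
      using e1 by (intro mult_right_mono) auto
    moreover have "e * q * (\<beta> s)\<^sup>2 \<le> p * q * (\<beta> s)\<^sup>2"
      using ep q by (intro mult_right_mono) auto
    ultimately have "U' s \<le> - e * ((\<alpha> s)\<^sup>2 + q * (\<beta> s)\<^sup>2)"
      by (simp add: U'_def algebra_simps)
    moreover have "2 / 3 * e * U s \<le> 2 / 3 * e * (3 / 2 * ((\<alpha> s)\<^sup>2 + q * (\<beta> s)\<^sup>2))"
      using U_upper[of s] e by (intro mult_left_mono) auto
    ultimately show ?thesis by (simp add: algebra_simps)
  qed
  then have U0: "(U \<longlongrightarrow> 0) at_top"
    using order_trans[OF energy_nonneg U_lower] e
    by (intro tendsto_zero_of_exponential_decay[OF dU, of "2 / 3 * e"]) auto
  have "((\<lambda>s. (\<alpha> s)\<^sup>2) \<longlongrightarrow> 0) at_top"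
  proof (rule tendsto_sandwich[OF _ _ tendsto_const])
    show "((\<lambda>s. 2 * U s) \<longlongrightarrow> 0) at_top" using tendsto_mult_right_zero[OF U0] .
    have "(\<alpha> s)\<^sup>2 \<le> 2 * U s" for s
    proof -
      have "0 \<le> q * (\<beta> s)\<^sup>2" using q by simp
      then show ?thesis using U_lower[of s] by linarith
    qed
    then show "\<forall>\<^sub>F s in at_top. (\<alpha> s)\<^sup>2 \<le> 2 * U s" by simp
  qed simp
  then show "(\<alpha> \<longlongrightarrow> 0) at_top" by (simp add: tendsto_null_power)
  have "((\<lambda>s. (\<beta> s)\<^sup>2) \<longlongrightarrow> 0) at_top"
  proof (rule tendsto_sandwich[OF _ _ tendsto_const])
    show "((\<lambda>s. 2 / q * U s) \<longlongrightarrow> 0) at_top" using tendsto_mult_right_zero[OF U0] .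
    have "q * (\<beta> s)\<^sup>2 \<le> 2 * U s" for s
      using U_lower[of s] zero_le_power2[of "\<alpha> s"] by linarith
    then have "(\<beta> s)\<^sup>2 \<le> 2 / q * U s" for s
      using q by (simp add: field_simps)
    then show "\<forall>\<^sub>F s in at_top. (\<beta> s)\<^sup>2 \<le> 2 / q * U s" by simp
  qed simp
  then show "(\<beta> \<longlongrightarrow> 0) at_top" by (simp add: tendsto_null_power)
qed

section \<open>Spectral decomposition of symmetric matrices\<close>

text \<open>The quadratic form attains its maximum on the unit sphere of the orthogonal complement
  of \<open>B\<close>, which is nonempty since \<open>B\<close> has too few vectors to span. That
  complement is invariant under \<open>A\<close>, so the residual \<open>A x - \<mu> x\<close> is an
  admissible direction of variation, and maximality forces it to be 0.\<close>

lemma orthonormal_eigenvector_extension: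
  fixes A :: "real^'n::finite^'n"
  assumes sym: "transpose A = A" and B: "finite B" "card B < CARD('n)"
    and eig: "\<And>b. b \<in> B \<Longrightarrow> \<exists>l. A *v b = l *\<^sub>R b"
  obtains x l where "norm x = 1" "A *v x = l *\<^sub>R x" "\<And>b. b \<in> B \<Longrightarrow> x \<bullet> b = 0"
proof -
  define S where "S = {x. \<forall>b\<in>B. x \<bullet> b = 0}"
  have adj: "p \<bullet> (A *v q) = (A *v p) \<bullet> q" for p q
    using inner_transpose[of A p q] sym by simp
  have scale: "c *\<^sub>R x \<in> S" if "x \<in> S" for c x
    using that by (simp add: S_def)
  have add: "x + y \<in> S" if "x \<in> S" "y \<in> S" for x y
    using that by (simp add: S_def inner_add_left)
  have inv: "A *v x \<in> S" if x: "x \<in> S" for x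
    unfolding S_def
  proof safe
    fix b assume b: "b \<in> B"
    then obtain l where "A *v b = l *\<^sub>R b" using eig by blast
    then show "(A *v x) \<bullet> b = 0" using x b by (simp add: adj[symmetric] S_def)
  qed
  have "dim B \<le> card B" using B by (intro dim_le_card) (auto intro: span_base)
  then have "dim B < DIM(real^'n)" using B by simp
  then obtain x0 where x0: "x0 \<noteq> 0" "\<And>y. y \<in> span B \<Longrightarrow> orthogonal x0 y"
    using orthogonal_to_subspace_exists by blast
  then have x0S: "x0 \<in> S"
    by (auto simp: S_def orthogonal_def intro: span_base)
  have "S = (\<Inter>b\<in>B. {x. x \<bullet> b = 0})" by (auto simp: S_def)
  moreover have "closed {x. x \<bullet> b = 0}" for b :: "real^'n"
    using closed_hyperplane[of b 0] by (simp add: inner_commute)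
  ultimately have "closed S" by auto
  then have "compact (S \<inter> sphere 0 1)" by (intro closed_Int_compact) auto
  moreover have "(1 / norm x0) *\<^sub>R x0 \<in> S \<inter> sphere 0 1"
    using x0 x0S by (auto intro: scale)
  moreover have "continuous_on (S \<inter> sphere 0 1) (\<lambda>x. x \<bullet> (A *v x))"
    by (intro continuous_intros)
  ultimately have "\<exists>x\<in>S \<inter> sphere 0 1. \<forall>z\<in>S \<inter> sphere 0 1. z \<bullet> (A *v z) \<le> x \<bullet> (A *v x)"
    by (intro continuous_attains_sup) (auto simp only: empty_iff)
  then obtain x where x: "x \<in> S" "norm x = 1"
    and max: "\<And>z. z \<in> S \<inter> sphere 0 1 \<Longrightarrow> z \<bullet> (A *v z) \<le> x \<bullet> (A *v x)"
    by auto
  define \<mu> where "\<mu> = x \<bullet> (A *v x)"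
  have max': "z \<bullet> (A *v z) \<le> \<mu> * (z \<bullet> z)" if z: "z \<in> S" for z
  proof (cases "z = 0")
    case False
    have "((1 / norm z) *\<^sub>R z) \<bullet> (A *v ((1 / norm z) *\<^sub>R z)) \<le> \<mu>"
      unfolding \<mu>_def using z False by (intro max) (auto intro: scale)
    then have "(z \<bullet> (A *v z)) / (norm z * norm z) \<le> \<mu>"
      by (simp add: matrix_vector_mult_scaleR)
    then show ?thesis
      using False by (simp add: divide_le_eq power2_norm_eq_inner[symmetric] power2_eq_square)
  qed simp
  define y where "y = A *v x - \<mu> *\<^sub>R x"
  have y: "y \<in> S"
    using add[OF inv[OF x(1)] scale[OF x(1), of "- \<mu>"]] by (simp add: y_def)
  have xx: "x \<bullet> x = 1" using x(2) by (simp add: norm_eq_1)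
  have yx: "y \<bullet> x = 0"
    using xx by (simp add: y_def inner_diff_left \<mu>_def inner_commute[of "A *v x"])
  have yAx: "y \<bullet> (A *v x) = y \<bullet> y"
  proof -
    have "A *v x = y + \<mu> *\<^sub>R x" by (simp add: y_def)
    then show ?thesis using yx by (simp only: inner_add_right) simp
  qed
  define c where "c = \<mu> * (y \<bullet> y) - y \<bullet> (A *v y)"
  \<comment> \<open>Maximality along \<open>x + e y\<close>: the first-order gain is dominated by a
    second-order term, for every \<open>e\<close>.\<close>
  have quad: "2 * e * (y \<bullet> y) \<le> e\<^sup>2 * c" for e
  proof -
    have le: "(x + e *\<^sub>R y) \<bullet> (A *v (x + e *\<^sub>R y)) \<le> \<mu> * ((x + e *\<^sub>R y) \<bullet> (x + e *\<^sub>R y))"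
      by (intro max' add scale x y)
    have form: "(x + e *\<^sub>R y) \<bullet> (A *v (x + e *\<^sub>R y)) = \<mu> + 2 * e * (y \<bullet> y) + e\<^sup>2 * (y \<bullet> (A *v y))"
      using yAx adj[of x y]
      by (simp add: matrix_vector_right_distrib matrix_vector_mult_scaleR inner_add_left inner_add_right
          \<mu>_def inner_commute power2_eq_square algebra_simps)
    have norm: "(x + e *\<^sub>R y) \<bullet> (x + e *\<^sub>R y) = 1 + e\<^sup>2 * (y \<bullet> y)"
      using xx yx by (simp add: inner_add_left inner_add_right inner_commute power2_eq_square)
    show ?thesis using le[unfolded form norm] by (simp add: c_def algebra_simps)
  qed
  have "y \<bullet> y \<le> 0"
  proof (rule ccontr)
    assume "\<not> y \<bullet> y \<le> 0"
    then have pos: "0 < y \<bullet> y" by linarith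
    \<comment> \<open>Small enough that \<open>e * c\<close> is at most
      \<open>y \<bullet> y\<close>, contradicting the lower bound
      \<open>2 * (y \<bullet> y)\<close>.\<close>
    define e where "e = (y \<bullet> y) / (\<bar>c\<bar> + 1)"
    have e: "0 < e" using pos by (simp add: e_def add_nonneg_pos)
    have "e * (2 * (y \<bullet> y)) \<le> e * (e * c)"
      using quad[of e] by (simp add: power2_eq_square mult.assoc mult.left_commute)
    then have "2 * (y \<bullet> y) \<le> e * c" using e by simp
    also have "e * c \<le> e * (\<bar>c\<bar> + 1)" using e by (intro mult_left_mono) auto
    also have "\<dots> = y \<bullet> y" by (simp add: e_def)
    finally show False using pos by linarith
  qed
  then have "y \<bullet> y = 0" using inner_ge_zero[of y] by linarith
  then have "y = 0" by simp
  then have "A *v x = \<mu> *\<^sub>R x" by (simp add: y_def)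
  then show thesis using x by (intro that[of x \<mu>]) (auto simp: S_def)
qed

lemma symmetric_orthonormal_eigenbasis:
  fixes A :: "real^'n::finite^'n"
  assumes sym: "transpose A = A"
  obtains v :: "'n \<Rightarrow> real^'n" and l :: "'n \<Rightarrow> real"
  where "\<And>i. A *v v i = l i *\<^sub>R v i" "\<And>i j. v i \<bullet> v j = (if i = j then 1 else 0)"
proof -
  have ex: "\<exists>B. finite B \<and> card B = k \<and> (\<forall>b\<in>B. norm b = 1 \<and> (\<exists>l. A *v b = l *\<^sub>R b)) \<and>
      (\<forall>b\<in>B. \<forall>c\<in>B. b \<noteq> c \<longrightarrow> b \<bullet> c = 0)" if "k \<le> CARD('n)" for k
    using that
  proof (induction k)
    case 0
    then show ?case by (intro exI[of _ "{}"]) auto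
  next
    case (Suc k)
    then obtain B where B: "finite B" "card B = k" "\<And>b. b \<in> B \<Longrightarrow> norm b = 1"
      "\<And>b. b \<in> B \<Longrightarrow> \<exists>l. A *v b = l *\<^sub>R b" "\<And>b c. b \<in> B \<Longrightarrow> c \<in> B \<Longrightarrow> b \<noteq> c \<Longrightarrow> b \<bullet> c = 0"
      by (auto simp: Suc_le_eq)
    obtain x l where x: "norm x = 1" "A *v x = l *\<^sub>R x" "\<And>b. b \<in> B \<Longrightarrow> x \<bullet> b = 0"
      using orthonormal_eigenvector_extension[OF sym B(1) _ B(4)] B(2) Suc.prems by auto
    have "x \<notin> B" using x by force
    then show ?case
      using B x by (intro exI[of _ "insert x B"]) (auto simp: inner_commute)
  qed
  from ex[OF order_refl] obtain B where B: "finite B \<and> card B = CARD('n) \<and>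
      (\<forall>b\<in>B. norm b = 1 \<and> (\<exists>l. A *v b = l *\<^sub>R b)) \<and> (\<forall>b\<in>B. \<forall>c\<in>B. b \<noteq> c \<longrightarrow> b \<bullet> c = 0)" ..
  obtain v where v: "bij_betw v (UNIV :: 'n set) B"
    using finite_same_card_bij[OF finite, of B] B by metis
  then have vB: "v i \<in> B" and inj: "v i = v j \<longleftrightarrow> i = j" for i j
    by (auto simp: bij_betw_def inj_on_def)
  obtain l where l: "\<And>b. b \<in> B \<Longrightarrow> A *v b = l b *\<^sub>R b" using B by metis
  show thesis
    by (rule that[of v "\<lambda>i. l (v i)"]) (use l vB inj B in \<open>auto simp: norm_eq_1\<close>)
qed

text \<open>The vector \<open>y = S u - sqrt l u\<close> satisfies \<open>S y = - sqrt l y\<close>,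
  which a positive semidefinite \<open>S\<close> allows for \<open>l > 0\<close> only if
  \<open>y = 0\<close>. For \<open>l = 0\<close> the squared norm of \<open>S u\<close> is
  \<open>u \<bullet> S (S u) = 0\<close>.\<close>

lemma psd_root_eigenvector:
  fixes S :: "real^'n^'n"
  assumes sym: "transpose S = S" and psd: "\<And>x. 0 \<le> x \<bullet> (S *v x)" and sq: "S *v (S *v u) = l *\<^sub>R u"
    and l: "0 \<le> l"
  shows "S *v u = sqrt l *\<^sub>R u"
proof -
  have adj: "p \<bullet> (S *v q) = (S *v p) \<bullet> q" for p q
    using inner_transpose[of S p q] sym by simp
  define y where "y = S *v u - sqrt l *\<^sub>R u"
  have Sy: "S *v y = - sqrt l *\<^sub>R y"
    using l by (simp add: y_def matrix_vector_mult_diff_distrib sq matrix_vector_mult_scaleR scaleR_diff_right)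
  have "y = 0"
  proof (cases "l = 0")
    case True
    then have "y \<bullet> y = u \<bullet> (S *v (S *v u))" by (simp add: y_def adj)
    then show ?thesis using sq True by simp
  next
    case False
    have "0 \<le> - (sqrt l * (y \<bullet> y))" using psd[of y] by (simp add: Sy)
    then show ?thesis using False l
      by (metis inner_eq_zero_iff inner_ge_zero mult_eq_0_iff mult_nonneg_nonneg neg_0_le_iff_le order_antisym real_sqrt_eq_zero_cancel real_sqrt_ge_zero)
  qed
  then show ?thesis by (simp add: y_def)
qed

context
  fixes v :: "'n::finite \<Rightarrow> real^'n"
  assumes ortho: "\<And>i j. v i \<bullet> v j = (if i = j then 1 else 0)"
begin

lemma orthonormal_columns:
  "transpose (\<chi> a i. v i $ a) ** (\<chi> a i. v i $ a) = mat 1"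
  using ortho by (simp add: vec_eq_iff matrix_matrix_mult_def transpose_def mat_def inner_vec_def)

text \<open>Orthonormality says \<open>V\<^sup>T V = 1\<close>; for square matrices a left inverse
  is a right inverse, and \<open>V V\<^sup>T = 1\<close> is completeness.\<close>

lemma orthonormal_expansion: "x = (\<Sum>i\<in>UNIV. (v i \<bullet> x) *\<^sub>R v i)"
proof -
  let ?V = "\<chi> a i. v i $ a"
  have "?V ** transpose ?V = mat 1"
    using orthonormal_columns matrix_left_right_inverse by blast
  then have "x = ?V *v (transpose ?V *v x)"
    by (simp add: matrix_vector_mul_assoc del: transpose_matrix_vector)
  also have "transpose ?V *v x = (\<chi> i. v i \<bullet> x)"
    by (simp add: vec_eq_iff matrix_vector_mult_def transpose_def inner_vec_def del: transpose_matrix_vector)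
  also have "?V *v (\<chi> i. v i \<bullet> x) = (\<Sum>i\<in>UNIV. (v i \<bullet> x) *\<^sub>R v i)"
    by (simp add: vec_eq_iff matrix_vector_mult_def mult.commute)
  finally show ?thesis .
qed

lemma orthonormal_parseval: "x \<bullet> x = (\<Sum>i\<in>UNIV. (v i \<bullet> x)\<^sup>2)"
proof -
  have "x \<bullet> x = (\<Sum>i\<in>UNIV. (v i \<bullet> x) *\<^sub>R v i) \<bullet> x"
    using orthonormal_expansion[of x] by simp
  then show ?thesis by (simp add: inner_sum_left power2_eq_square)
qed

lemma matrix_eqI_orthonormal:
  fixes A B :: "real^'n^'m::finite"
  assumes "\<And>i. A *v v i = B *v v i"
  shows "A = B"
proof -
  have "A *v x = B *v x" for x
  proof -
    have "A *v (\<Sum>i\<in>UNIV. (v i \<bullet> x) *\<^sub>R v i) = B *v (\<Sum>i\<in>UNIV. (v i \<bullet> x) *\<^sub>R v i)"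
      by (simp add: linear_sum[OF matrix_vector_mul_linear] matrix_vector_mult_scaleR assms)
    then show ?thesis using orthonormal_expansion[of x] by simp
  qed
  then show ?thesis by (simp add: matrix_eq)
qed

text \<open>The columns of \<open>V\<close> are eigenvectors, so \<open>(x - A) V = V D\<close> with
  \<open>D\<close> diagonal, and \<open>det V\<close> cancels. The comparison is pointwise in
  \<open>x\<close>, because a real polynomial is determined by its values.\<close>

lemma charpoly_orthonormal_eigenbasis:
  fixes A :: "real^'n^'n"
  assumes eig: "\<And>i. A *v v i = l i *\<^sub>R v i"
  shows "charpoly A = (\<Prod>i\<in>UNIV. [:- l i, 1:])"
proof -
  have "poly (charpoly A) x = (\<Prod>i\<in>UNIV. x - l i)" for x
  proof -
    let ?V = "\<chi> a i. v i $ a" and ?xA = "x *\<^sub>R mat 1 - A" and ?D = "\<chi> i j. if i = j then x - l i else 0"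
    have eval: "poly (charpoly A) x = det ?xA"
      unfolding charpoly_def det_def
      by (simp add: poly_sum poly_prod mat_def if_distrib[of "\<lambda>p. poly p x"] cong: if_cong)
         (intro sum.cong prod.cong arg_cong2[where f="(*)"]; auto)
    have "det (?xA ** ?V) = det (?V ** ?D)"
    proof -
      have "(?xA ** ?V) $ a $ i = (?V ** ?D) $ a $ i" for a i
      proof -
        have "(?xA ** ?V) $ a $ i = (?xA *v v i) $ a"
          by (simp add: matrix_matrix_mult_def matrix_vector_mult_def)
        also have "?xA *v v i = (x - l i) *\<^sub>R v i"
          by (simp add: matrix_vector_mult_diff_rdistrib eig scaleR_matrix_vector_assoc[symmetric] scaleR_diff_left)
        also have "((x - l i) *\<^sub>R v i) $ a = (?V ** ?D) $ a $ i"
          by (simp add: matrix_matrix_mult_def if_distrib cong: if_cong)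
        finally show ?thesis .
      qed
      then have "?xA ** ?V = ?V ** ?D" by (simp only: vec_eq_iff) simp
      then show ?thesis by (rule arg_cong)
    qed
    then have prod: "det ?xA * det ?V = det ?V * det ?D"
      by (simp only: det_mul)
    have nz: "det ?V \<noteq> 0"
      using arg_cong[OF orthonormal_columns, of det] by (auto simp: det_mul)
    have diag: "det ?D = (\<Prod>i\<in>UNIV. x - l i)"
      by (subst det_diagonal) auto
    show ?thesis
      using mult_right_cancel[OF nz, THEN iffD1, OF prod[unfolded diag mult.commute[of "det ?V"]]] eval
      by (rule trans[rotated])
  qed
  then have "poly (charpoly A) = poly (\<Prod>i\<in>UNIV. [:- l i, 1:])"
    by (auto simp: poly_prod)
  then show ?thesis by (simp add: poly_eq_poly_eq_iff)
qed

text \<open>\<open>eigval\<close> lists the roots of the characteristic polynomial in increasing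
  order, the basis in an arbitrary one; a sum over all of them depends only on the multiset.\<close>

lemma sum_eigval_orthonormal_eigenbasis:
  fixes A :: "real^'n^'n" and f :: "real \<Rightarrow> real"
  assumes eig: "\<And>i. A *v v i = l i *\<^sub>R v i"
  shows "(\<Sum>i = 1..CARD('n). f (eigval A i)) = (\<Sum>i\<in>UNIV. f (l i))"
proof -
  have "proots (charpoly A) = (\<Sum>i\<in>UNIV. {#l i#})"
    unfolding charpoly_orthonormal_eigenbasis[OF eig] by (subst proots_prod) auto
  also have "\<dots> = image_mset l (mset_set UNIV)"
    by (simp add: sum_unfold_sum_mset)
  finally have roots: "proots (charpoly A) = image_mset l (mset_set UNIV)" .
  let ?xs = "sorted_list_of_multiset (proots (charpoly A))"
  have mset: "mset ?xs = image_mset l (mset_set UNIV)" by (simp add: roots)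
  have len: "length ?xs = CARD('n)"
    using arg_cong[OF mset, of size] by (simp only: size_mset size_image_mset size_mset_set)
  \<comment> \<open>\<open>eigval\<close> counts from 1, list positions from 0.\<close>
  have "(\<Sum>i = 1..CARD('n). f (eigval A i)) = (\<Sum>i<CARD('n). f (?xs ! i))"
    by (rule sum.reindex_bij_witness[of _ Suc "\<lambda>i. i - 1"]) (auto simp: eigval_def)
  also have "\<dots> = sum_list (map f ?xs)"
    using len by (simp add: sum_list_sum_nth atLeast0LessThan)
  also have "\<dots> = sum_mset (image_mset f (mset ?xs))"
    by (metis mset_map sum_mset_sum_list)
  also have "\<dots> = (\<Sum>i\<in>UNIV. f (l i))"
    unfolding mset by (simp add: sum_unfold_sum_mset multiset.map_comp o_def)
  finally show ?thesis .
qed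

text \<open>The definite description is justified by both halves: the spectral sum with weights
  \<open>sqrt (l i)\<close> is a root, and by \<open>psd_root_eigenvector\<close> all roots agree on
  the eigenbasis.\<close>

lemma psd_sqrt_eigenvector:
  fixes A :: "real^'n^'n"
  assumes eig: "\<And>i. A *v v i = l i *\<^sub>R v i" and nonneg: "\<And>i. 0 \<le> l i"
  shows "transpose (psd_sqrt A) = psd_sqrt A" and "psd_sqrt A *v v i = sqrt (l i) *\<^sub>R v i"
proof -
  let ?P = "\<lambda>S. transpose S = S \<and> (\<forall>x. 0 \<le> x \<bullet> (S *v x)) \<and> S ** S = A"
  have root: "S *v v i = sqrt (l i) *\<^sub>R v i" if "?P S" for S i
    using that eig nonneg by (intro psd_root_eigenvector) (auto simp: matrix_vector_mul_assoc)
  define S where "S = (\<chi> a b. \<Sum>i\<in>UNIV. sqrt (l i) * v i $ a * v i $ b)"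
  have Sx: "S *v x = (\<Sum>i\<in>UNIV. (sqrt (l i) * (v i \<bullet> x)) *\<^sub>R v i)" for x
  proof -
    have "(S *v x) $ a = (\<Sum>b\<in>UNIV. \<Sum>i\<in>UNIV. sqrt (l i) * v i $ a * (v i $ b * x $ b))" for a
      by (simp add: S_def matrix_vector_mult_def sum_distrib_right mult.assoc)
    also have "\<dots> a = (\<Sum>i\<in>UNIV. \<Sum>b\<in>UNIV. sqrt (l i) * v i $ a * (v i $ b * x $ b))" for a
      by (rule sum.swap)
    finally show ?thesis
      by (simp add: vec_eq_iff inner_vec_def sum_distrib_left mult_ac)
  qed
  have Sv: "S *v v j = sqrt (l j) *\<^sub>R v j" for j
    by (simp add: Sx ortho if_distrib if_distribR cong: if_cong)
  have "?P S"
  proof (intro conjI allI)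
    show "transpose S = S" by (simp add: S_def transpose_def vec_eq_iff mult_ac)
    have "x \<bullet> (S *v x) = (\<Sum>i\<in>UNIV. sqrt (l i) * (v i \<bullet> x)\<^sup>2)" for x
      by (simp add: Sx inner_sum_right inner_commute power2_eq_square mult.assoc)
    then show "0 \<le> x \<bullet> (S *v x)" for x by (simp add: sum_nonneg nonneg)
    show "S ** S = A"
      by (rule matrix_eqI_orthonormal)
         (simp add: matrix_vector_mul_assoc[symmetric] Sv eig matrix_vector_mult_scaleR nonneg)
  qed
  moreover have "S' = S" if "?P S'" for S'
    by (rule matrix_eqI_orthonormal) (use root[OF that] Sv in simp)
  ultimately have "?P (psd_sqrt A)"
    unfolding psd_sqrt_def by (rule theI)
  then show "transpose (psd_sqrt A) = psd_sqrt A" "psd_sqrt A *v v i = sqrt (l i) *\<^sub>R v i"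
    using root by auto
qed

end

section \<open>Symmetry and semidefiniteness of the Laplacian\<close>

lemma transpose_laplacian: "transpose (laplacian E src tgt b) = laplacian E src tgt b"
  by (simp add: laplacian_def transpose_def vec_eq_iff mult_ac)

text \<open>The form is a weighted sum of the squared entries of \<open>B\<^sup>T x\<close>;
  positive edge weights therefore make all eigenvalues nonnegative.\<close>

lemma laplacian_quadratic_form:
  "x \<bullet> (laplacian E src tgt b *v x) = (\<Sum>e\<in>E. b e * (\<Sum>i\<in>UNIV. incidence src tgt i e * x $ i)\<^sup>2)"
proof -
  let ?c = "incidence src tgt"
  have "x \<bullet> (laplacian E src tgt b *v x)
      = (\<Sum>i\<in>UNIV. \<Sum>j\<in>UNIV. \<Sum>e\<in>E. b e * ((?c i e * x $ i) * (?c j e * x $ j)))"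
    by (simp add: inner_vec_def matrix_vector_mult_def laplacian_def sum_distrib_left sum_distrib_right mult_ac)
  also have "\<dots> = (\<Sum>i\<in>UNIV. \<Sum>e\<in>E. \<Sum>j\<in>UNIV. b e * ((?c i e * x $ i) * (?c j e * x $ j)))"
    by (intro sum.cong refl sum.swap)
  also have "\<dots> = (\<Sum>e\<in>E. \<Sum>i\<in>UNIV. \<Sum>j\<in>UNIV. b e * ((?c i e * x $ i) * (?c j e * x $ j)))"
    by (rule sum.swap)
  also have "\<dots> = (\<Sum>e\<in>E. b e * (\<Sum>i\<in>UNIV. ?c i e * x $ i)\<^sup>2)"
    by (simp only: power2_eq_square sum_product) (simp add: sum_distrib_left)
  finally show ?thesis .
qed

section \<open>The homogeneous system\<close>

definition stacked :: "real^'a::finite \<Rightarrow> real^'b::finite \<Rightarrow> real^('a + 'b)" where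
  "stacked p q = (\<chi> i. case i of Inl a \<Rightarrow> p $ a | Inr b \<Rightarrow> q $ b)"

lemma sum_UNIV_Plus:
  fixes f :: "'a::finite + 'b::finite \<Rightarrow> 'c::comm_monoid_add"
  shows "sum f UNIV = (\<Sum>a\<in>UNIV. f (Inl a)) + (\<Sum>b\<in>UNIV. f (Inr b))"
  using sum.Plus[of "UNIV :: 'a set" "UNIV :: 'b set" f] by (simp add: UNIV_Plus_UNIV)

lemma stacked_cases: obtains p q where "x = stacked p q"
proof
  show "x = stacked (\<chi> a. x $ Inl a) (\<chi> b. x $ Inr b)"
    by (simp add: stacked_def vec_eq_iff split: sum.split)
qed

lemma inner_stacked: "stacked p q \<bullet> stacked p' q' = p \<bullet> p' + q \<bullet> q'"
  by (simp add: stacked_def inner_vec_def sum_UNIV_Plus)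

lemma block_matrix_mult_stacked:
  "block_matrix P Q S T *v stacked p q = stacked (P *v p + Q *v q) (S *v p + T *v q)"
  by (simp add: stacked_def block_matrix_def matrix_vector_mult_def vec_eq_iff sum_UNIV_Plus split: sum.split)

lemma transpose_block_matrix:
  "transpose (block_matrix P Q S T) = block_matrix (transpose P) (transpose S) (transpose Q) (transpose T)"
  by (simp add: block_matrix_def transpose_def vec_eq_iff split: sum.split)

lemma transpose_block_column_mult_stacked:
  "transpose (block_column P Q) *v stacked p q = transpose P *v p + transpose Q *v q"
  by (simp add: stacked_def block_column_def transpose_def matrix_vector_mult_def vec_eq_iff sum_UNIV_Plus
      del: transpose_matrix_vector)

lemma transpose_zero: "transpose (0 :: real^'a^'b) = 0"
  by (simp add: transpose_def vec_eq_iff)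

lemma transpose_scaleR: "transpose (c *\<^sub>R A :: real^'a^'b) = c *\<^sub>R transpose A"
  by (simp add: transpose_def vec_eq_iff)

text \<open>Parseval in each block. The eigenvalue is moved into the functional, so that every
  summand is the square of a linear functional of the state, the form that the moment formula
  treats.\<close>

lemma output_inner_eigenbasis:
  fixes v :: "'n::finite \<Rightarrow> real^'n" and L :: "real^'n^'n"
  assumes ortho: "\<And>i j. v i \<bullet> v j = (if i = j then 1 else 0)"
    and eig: "\<And>i. L *v v i = l i *\<^sub>R v i" and sym: "transpose L = L"
  shows "(block_matrix L 0 0 (mat 1) *v x) \<bullet> (block_matrix L 0 0 (mat 1) *v x)
    = (\<Sum>i\<in>UNIV. ((l i *\<^sub>R stacked (v i) 0) \<bullet> x)\<^sup>2 + (stacked 0 (v i) \<bullet> x)\<^sup>2)"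
proof -
  obtain p q where x: "x = stacked p q" by (rule stacked_cases)
  have "v i \<bullet> (L *v p) = l i * (v i \<bullet> p)" for i
    using inner_transpose[of L "v i" p] sym eig by simp
  then have "(L *v p) \<bullet> (L *v p) = (\<Sum>i\<in>UNIV. (l i * (v i \<bullet> p))\<^sup>2)"
    by (simp add: orthonormal_parseval[OF ortho, of "L *v p"])
  moreover have "q \<bullet> q = (\<Sum>i\<in>UNIV. (v i \<bullet> q)\<^sup>2)"
    by (rule orthonormal_parseval[OF ortho])
  ultimately show ?thesis
    by (simp add: x block_matrix_mult_stacked inner_stacked sum.distrib)
qed

text \<open>The adjoint equation preserves the plane spanned by \<open>(v, 0)\<close> and \<open>(0, v)\<close>, where it reads
  \<open>\<alpha>' = - (l / m) \<beta>\<close>, \<open>\<beta>' = \<alpha> - (d / m) \<beta>\<close> in reversed time, and there the noise intensity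
  \<open>\<gamma> l \<beta>\<^sup>2 / m\<^sup>2\<close> is \<open>\<gamma> / d\<close> times the rate of energy dissipation.\<close>

lemma (in prob_space) homogeneous_mode_second_moment:
  fixes L :: "real^'n::finite^'n" and W :: "real \<Rightarrow> 'a \<Rightarrow> real^'n" and X :: "real \<Rightarrow> 'a \<Rightarrow> real^('n + 'n)"
  assumes W: "wiener_process M W"
    and sol: "linear_sde_solution M (block_matrix 0 (mat 1) (- (1 / m) *\<^sub>R L) (- (d / m) *\<^sub>R mat 1))
      (block_column 0 ((1 / m * sqrt \<gamma>) *\<^sub>R psd_sqrt L)) W X" (is "linear_sde_solution M ?A ?R W X")
    and ind: "independent_of_process M (X 0) W"
    and X0: "integrable M (\<lambda>w. (norm (X 0 w))\<^sup>2)"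
    and pos: "0 < m" "0 < d" "0 < \<gamma>" "0 \<le> l"
    and sym: "transpose L = L" "transpose (psd_sqrt L) = psd_sqrt L"
    and eig: "L *v v = l *\<^sub>R v" "psd_sqrt L *v v = sqrt l *\<^sub>R v" and norm_v: "norm v = 1"
    and \<alpha>: "\<And>s. (\<alpha> has_real_derivative - (l / m) * \<beta> s) (at s)"
    and \<beta>: "\<And>s. (\<beta> has_real_derivative \<alpha> s - (d / m) * \<beta> s) (at s)"
    and t: "0 < t"
  shows "has_bochner_integral M (\<lambda>w. ((\<alpha> 0 *\<^sub>R stacked v 0 + \<beta> 0 *\<^sub>R stacked 0 v) \<bullet> X t w)\<^sup>2)
     ((\<integral>w. ((\<alpha> t *\<^sub>R stacked v 0 + \<beta> t *\<^sub>R stacked 0 v) \<bullet> X 0 w)\<^sup>2 \<partial>M) +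
      \<gamma> / (2 * d) * ((\<alpha> 0)\<^sup>2 + l / m * (\<beta> 0)\<^sup>2 - (\<alpha> t)\<^sup>2 - l / m * (\<beta> t)\<^sup>2))"
proof -
  define A where "A = ?A"
  define R where "R = ?R"
  let ?p = "stacked v 0 :: real^('n + 'n)" and ?q = "stacked 0 v :: real^('n + 'n)"
  \<comment> \<open>Time reversal puts the prescribed coefficients at the terminal time:
    \<open>a t\<close> carries \<open>\<alpha> 0\<close> and \<open>\<beta> 0\<close> and meets
    \<open>X t\<close>, while \<open>a 0\<close> carries the decayed values
    \<open>\<alpha> t\<close> and \<open>\<beta> t\<close> and meets \<open>X 0\<close>.\<close>
  define a where "a s = \<alpha> (t - s) *\<^sub>R ?p + \<beta> (t - s) *\<^sub>R ?q" for s
  have Ap: "transpose A *v ?p = ?q"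
    by (simp add: A_def transpose_block_matrix block_matrix_mult_stacked transpose_zero
        del: transpose_matrix_vector)
  have Aq: "transpose A *v ?q = - (l / m) *\<^sub>R ?p - (d / m) *\<^sub>R ?q"
  proof -
    have "transpose (- (1 / m) *\<^sub>R L) *v v = (- (l / m)) *\<^sub>R v"
      by (simp only: transpose_scaleR sym scaleR_matrix_vector_assoc[symmetric] eig) simp
    moreover have "transpose (- (d / m) *\<^sub>R mat 1) *v v = (- (d / m)) *\<^sub>R v"
      by (simp only: transpose_scaleR transpose_mat scaleR_matrix_vector_assoc[symmetric] matrix_vector_mul_lid)
    ultimately have "transpose A *v ?q = stacked ((- (l / m)) *\<^sub>R v) ((- (d / m)) *\<^sub>R v)"
      unfolding A_def transpose_block_matrix block_matrix_mult_stacked by (simp only:) simp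
    also have "\<dots> = - (l / m) *\<^sub>R ?p - (d / m) *\<^sub>R ?q"
      by (simp add: stacked_def vec_eq_iff split: sum.split)
    finally show ?thesis .
  qed
  have Rp: "transpose R *v ?p = 0"
    by (simp add: R_def transpose_block_column_mult_stacked transpose_zero del: transpose_matrix_vector)
  have Rq: "transpose R *v ?q = (sqrt \<gamma> / m * sqrt l) *\<^sub>R v"
    by (simp add: R_def transpose_block_column_mult_stacked transpose_zero transpose_scaleR sym
        scaleR_matrix_vector_assoc[symmetric] eig del: transpose_matrix_vector)
  have rev: "((\<lambda>s. t - s) has_real_derivative - 1) (at s within T)" for s T
    by (auto intro!: derivative_eq_intros)
  have \<alpha>_rev: "((\<lambda>s. \<alpha> (t - s)) has_real_derivative l / m * \<beta> (t - s)) (at s within T)" for s T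
    using DERIV_chain2[OF \<alpha> rev] by simp
  have \<beta>_rev: "((\<lambda>s. \<beta> (t - s)) has_real_derivative d / m * \<beta> (t - s) - \<alpha> (t - s)) (at s within T)" for s T
    using DERIV_chain2[OF \<beta> rev] by simp
  have a: "(a has_vector_derivative - (transpose A *v a s)) (at s within {0..t})" for s
  proof -
    have "(a has_vector_derivative
        (\<alpha> (t - s) *\<^sub>R 0 + (l / m * \<beta> (t - s)) *\<^sub>R ?p) +
        (\<beta> (t - s) *\<^sub>R 0 + (d / m * \<beta> (t - s) - \<alpha> (t - s)) *\<^sub>R ?q)) (at s within {0..t})"
      unfolding a_def[abs_def]
      by (intro has_vector_derivative_add has_vector_derivative_scaleR has_vector_derivative_const
          \<alpha>_rev \<beta>_rev)
    moreover have "(\<alpha> (t - s) *\<^sub>R 0 + (l / m * \<beta> (t - s)) *\<^sub>R ?p) +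
        (\<beta> (t - s) *\<^sub>R 0 + (d / m * \<beta> (t - s) - \<alpha> (t - s)) *\<^sub>R ?q) = - (transpose A *v a s)"
      by (simp add: a_def matrix_vector_right_distrib matrix_vector_mult_scaleR Ap Aq algebra_simps
          del: transpose_matrix_vector)
    ultimately show ?thesis by simp
  qed
  have noise: "(norm (transpose R *v a s))\<^sup>2 = \<gamma> * l / m\<^sup>2 * (\<beta> (t - s))\<^sup>2" for s
  proof -
    have "transpose R *v a s = (\<beta> (t - s) * (sqrt \<gamma> / m * sqrt l)) *\<^sub>R v"
      by (simp add: a_def matrix_vector_right_distrib matrix_vector_mult_scaleR Rp Rq
          del: transpose_matrix_vector)
    then show ?thesis
      using pos by (simp add: norm_v power_mult_distrib power_divide del: transpose_matrix_vector)
  qed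
  \<comment> \<open>A primitive of the noise intensity: in the derivative of the reversed energy the
    products \<alpha> \<beta> cancel and the damping leaves
    \<open>2 * d * l * \<beta>\<^sup>2 / m\<^sup>2\<close>, which the prefactor turns into
    \<open>\<gamma> * l * \<beta>\<^sup>2 / m\<^sup>2\<close>.\<close>
  define E where "E s = \<gamma> / (2 * d) * ((\<alpha> (t - s))\<^sup>2 + l / m * (\<beta> (t - s))\<^sup>2)" for s
  have "(E has_real_derivative \<gamma> * l / m\<^sup>2 * (\<beta> (t - s))\<^sup>2) (at s within {0..t})" for s
  proof -
    show ?thesis
      unfolding E_def[abs_def] using pos
      by (auto intro!: derivative_eq_intros \<alpha>_rev \<beta>_rev simp: field_simps power2_eq_square)
  qed
  then have "((\<lambda>s. \<gamma> * l / m\<^sup>2 * (\<beta> (t - s))\<^sup>2) has_integral E t - E 0) {0..t}"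
    using t by (intro fundamental_theorem_of_calculus) (auto simp: has_real_derivative_iff_has_vector_derivative)
  then have int: "integral {0..t} (\<lambda>s. (norm (transpose R *v a s))\<^sup>2) = E t - E 0"
    unfolding noise by (rule integral_unique)
  show ?thesis
    using linear_sde_functional_second_moment[OF W sol[folded A_def R_def] ind X0 t a]
    unfolding int by (simp add: a_def E_def algebra_simps)
qed

text \<open>For \<open>l = 0\<close> the adjoint component \<alpha> is conserved, so a functional
  involving the phase along \<open>v\<close> would keep a trace of the initial state;
  \<open>kernel\<close> excludes this case, and \<beta> alone decays exponentially. For
  \<open>l > 0\<close> both components decay. By Cauchy-Schwarz the contribution of
  \<open>X 0\<close> vanishes with them.\<close>

lemma (in prob_space) homogeneous_mode_limit:
  fixes L :: "real^'n::finite^'n" and W :: "real \<Rightarrow> 'a \<Rightarrow> real^'n" and X :: "real \<Rightarrow> 'a \<Rightarrow> real^('n + 'n)"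
    and x y :: real
  assumes W: "wiener_process M W"
    and sol: "linear_sde_solution M (block_matrix 0 (mat 1) (- (1 / m) *\<^sub>R L) (- (d / m) *\<^sub>R mat 1))
      (block_column 0 ((1 / m * sqrt \<gamma>) *\<^sub>R psd_sqrt L)) W X"
    and ind: "independent_of_process M (X 0) W"
    and X0: "integrable M (\<lambda>w. (norm (X 0 w))\<^sup>2)"
    and pos: "0 < m" "0 < d" "0 < \<gamma>" "0 \<le> l"
    and sym: "transpose L = L" "transpose (psd_sqrt L) = psd_sqrt L"
    and eig: "L *v v = l *\<^sub>R v" "psd_sqrt L *v v = sqrt l *\<^sub>R v" and norm_v: "norm v = 1"
    and kernel: "l = 0 \<Longrightarrow> x = 0"
  defines "\<phi> \<equiv> x *\<^sub>R stacked v 0 + y *\<^sub>R stacked 0 v"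
  shows "0 \<le> t \<Longrightarrow> integrable M (\<lambda>w. (\<phi> \<bullet> X t w)\<^sup>2)"
    and "((\<lambda>t. \<integral>w. (\<phi> \<bullet> X t w)\<^sup>2 \<partial>M) \<longlongrightarrow> \<gamma> / (2 * d) * (x\<^sup>2 + l / m * y\<^sup>2)) at_top"
proof -
  obtain \<alpha> \<beta> where init: "\<alpha> 0 = x" "\<beta> 0 = y"
    and \<alpha>: "\<And>s. (\<alpha> has_real_derivative - (l / m) * \<beta> s) (at s)"
    and \<beta>: "\<And>s. (\<beta> has_real_derivative \<alpha> s - (d / m) * \<beta> s) (at s)"
    and lim: "(\<alpha> \<longlongrightarrow> 0) at_top" "(\<beta> \<longlongrightarrow> 0) at_top"
  proof (cases "l = 0")
    case True
    show thesis
    proof (rule that[of "\<lambda>_. 0" "\<lambda>s. y * exp (- (d / m) * s)"])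
      show "((\<lambda>s. y * exp (- (d / m) * s)) \<longlongrightarrow> 0) at_top"
        using pos by (intro tendsto_exponential_decay) simp
    qed (use True kernel pos in \<open>auto intro!: derivative_eq_intros\<close>)
  next
    case False
    then have "0 < d / m" "0 < l / m" using pos by auto
    then show thesis
      using that damped_oscillator_decay damped_oscillator_solution[of x y "l / m" "d / m"] by metis
  qed
  have mX0: "X 0 \<in> borel_measurable M" using sol by (auto simp: linear_sde_solution_def)
  let ?\<psi> = "\<lambda>t. \<alpha> t *\<^sub>R stacked v 0 + \<beta> t *\<^sub>R stacked 0 v"
  let ?e = "\<lambda>t. (\<integral>w. (?\<psi> t \<bullet> X 0 w)\<^sup>2 \<partial>M) +
      \<gamma> / (2 * d) * (x\<^sup>2 + l / m * y\<^sup>2 - (\<alpha> t)\<^sup>2 - l / m * (\<beta> t)\<^sup>2)"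
  have moment: "has_bochner_integral M (\<lambda>w. (\<phi> \<bullet> X t w)\<^sup>2) (?e t)" if "0 < t" for t
    using homogeneous_mode_second_moment[OF W sol ind X0 pos sym eig norm_v \<alpha> \<beta> that]
    by (simp add: init \<phi>_def)
  \<comment> \<open>The moment formula covers \<open>t > 0\<close>; at \<open>t = 0\<close>
    square-integrability of the initial state takes over.\<close>
  show "integrable M (\<lambda>w. (\<phi> \<bullet> X t w)\<^sup>2)" if "0 \<le> t"
    using moment[of t] square_integrable_inner(1)[OF mX0 X0, of \<phi>] that
    by (cases "t = 0") (auto simp: has_bochner_integral_iff)
  have "((\<lambda>t. \<integral>w. (?\<psi> t \<bullet> X 0 w)\<^sup>2 \<partial>M) \<longlongrightarrow> 0) at_top"
  proof (rule tendsto_sandwich[OF _ _ tendsto_const])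
    have "((\<lambda>t. (norm (?\<psi> t))\<^sup>2 * (\<integral>w. (norm (X 0 w))\<^sup>2 \<partial>M)) \<longlongrightarrow>
        (norm (0 *\<^sub>R stacked v 0 + 0 *\<^sub>R stacked 0 v))\<^sup>2 * (\<integral>w. (norm (X 0 w))\<^sup>2 \<partial>M)) at_top"
      by (intro tendsto_intros lim)
    then show "((\<lambda>t. (norm (?\<psi> t))\<^sup>2 * (\<integral>w. (norm (X 0 w))\<^sup>2 \<partial>M)) \<longlongrightarrow> 0) at_top" by simp
  qed (use square_integrable_inner(2)[OF mX0 X0] in \<open>auto intro!: always_eventually\<close>)
  then have "(?e \<longlongrightarrow> 0 + \<gamma> / (2 * d) * (x\<^sup>2 + l / m * y\<^sup>2 - 0\<^sup>2 - l / m * 0\<^sup>2)) at_top"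
    by (intro tendsto_intros lim)
  moreover have "\<forall>\<^sub>F t in at_top. ?e t = (\<integral>w. (\<phi> \<bullet> X t w)\<^sup>2 \<partial>M)"
    using eventually_gt_at_top[of 0] by eventually_elim (use moment in \<open>simp add: has_bochner_integral_iff\<close>)
  ultimately show "((\<lambda>t. \<integral>w. (\<phi> \<bullet> X t w)\<^sup>2 \<partial>M) \<longlongrightarrow> \<gamma> / (2 * d) * (x\<^sup>2 + l / m * y\<^sup>2)) at_top"
    by (simp add: tendsto_cong)
qed

theorem mainTheorem1:
  fixes E :: "'n::finite set set"
    and src tgt :: "'n set \<Rightarrow> 'n"
    and b :: "'n set \<Rightarrow> real"
    and L :: "real^'n^'n"
    and m d \<gamma> :: real
    and A :: "real^('n + 'n)^('n + 'n)"
    and R :: "real^'n^('n + 'n)"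
    and C :: "real^('n + 'n)^('n + 'n)"
    and \<Omega> :: "'w measure"
    and W :: "real \<Rightarrow> 'w \<Rightarrow> real^'n"
    and X :: "real \<Rightarrow> 'w \<Rightarrow> real^('n + 'n)"
    and \<xi>\<^sub>0 :: "real^('n + 'n)"
    and \<Sigma>\<^sub>0 :: "real^('n + 'n)^('n + 'n)"
  assumes "simple_graph E"
    and "orientation E src tgt"
    and "\<And>e. e \<in> E \<Longrightarrow> b e > 0"
    and "L = laplacian E src tgt b"
    and "eigval L 1 = 0"
    and "2 \<le> CARD('n) \<Longrightarrow> 0 < eigval L 2"
    and "m > 0" and "d > 0" and "\<gamma> > 0"
    and "A = block_matrix 0 (mat 1) (- (1 / m) *\<^sub>R L) (- (d / m) *\<^sub>R mat 1)"
    and "R = block_column 0 ((1 / m * sqrt \<gamma>) *\<^sub>R psd_sqrt L)"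
    and "C = block_matrix L 0 0 (mat 1)"
    and "prob_space \<Omega>"
    and "wiener_process \<Omega> W"
    and "linear_sde_solution \<Omega> A R W X"
    and "distr \<Omega> borel (X 0) = gaussian \<xi>\<^sub>0 \<Sigma>\<^sub>0"
    and "independent_of_process \<Omega> (X 0) W"
  shows "has_H2_norm_sq \<Omega> C X
           (\<gamma> / (2 * d) * (\<Sum>i = 2..CARD('n). (eigval L i)\<^sup>2 + eigval L i / m))"
proof -
  interpret prob_space \<Omega> by fact
  have sym: "transpose L = L" using \<open>L = _\<close> transpose_laplacian by simp
  obtain v :: "'n \<Rightarrow> real^'n" and l :: "'n \<Rightarrow> real" where eig: "\<And>i. L *v v i = l i *\<^sub>R v i"
    and ortho: "\<And>i j. v i \<bullet> v j = (if i = j then 1 else 0)"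
    by (rule symmetric_orthonormal_eigenbasis[OF sym], rule that)
  \<comment> \<open>Positivity of the edge weights enters here.\<close>
  have nonneg: "0 \<le> l i" for i
  proof -
    have "0 \<le> v i \<bullet> (L *v v i)"
      unfolding \<open>L = _\<close> laplacian_quadratic_form using assms(3)
      by (intro sum_nonneg mult_nonneg_nonneg) (auto intro: less_imp_le)
    then show ?thesis by (simp add: eig ortho)
  qed
  note root = psd_sqrt_eigenvector[OF ortho eig nonneg]
  have norm_v: "norm (v i) = 1" for i by (simp add: norm_eq_1 ortho)
  note sol = \<open>linear_sde_solution \<Omega> A R W X\<close>[unfolded \<open>A = _\<close> \<open>R = _\<close>]
  have "integrable (distr \<Omega> borel (X 0)) (\<lambda>x. (norm x)\<^sup>2)"
    using integrable_gaussian_norm_sq[of \<xi>\<^sub>0 \<Sigma>\<^sub>0] \<open>distr \<Omega> borel (X 0) = _\<close> by simp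
  moreover have "X 0 \<in> borel_measurable \<Omega>" using sol by (auto simp: linear_sde_solution_def)
  ultimately have X0: "integrable \<Omega> (\<lambda>w. (norm (X 0 w))\<^sup>2)"
    by (subst (asm) integrable_distr_eq) auto
  note mode = homogeneous_mode_limit[OF \<open>wiener_process \<Omega> W\<close> sol \<open>independent_of_process \<Omega> (X 0) W\<close> X0
      \<open>m > 0\<close> \<open>d > 0\<close> \<open>\<gamma> > 0\<close> nonneg sym root(1)]
  have out: "(C *v X t w) \<bullet> (C *v X t w)
      = (\<Sum>i\<in>UNIV. ((l i *\<^sub>R stacked (v i) 0) \<bullet> X t w)\<^sup>2 + (stacked 0 (v i) \<bullet> X t w)\<^sup>2)" for t w
    unfolding \<open>C = _\<close> by (rule output_inner_eigenbasis[OF ortho eig sym])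
  \<comment> \<open>Two functionals per mode. For the phase, \<open>x = l i\<close> meets the kernel
    condition by itself, since the weight vanishes with the eigenvalue; for the velocity,
    \<open>x = 0\<close> and \<open>y = 1\<close> are allowed also when
    \<open>l i = 0\<close>.\<close>
  have int: "integrable \<Omega> (\<lambda>w. ((l i *\<^sub>R stacked (v i) 0) \<bullet> X t w)\<^sup>2)"
    "integrable \<Omega> (\<lambda>w. (stacked 0 (v i) \<bullet> X t w)\<^sup>2)" if "0 \<le> t" for t i
    using mode(1)[OF eig root(2) norm_v, where x = "l i" and y = 0] mode(1)[OF eig root(2) norm_v, where x = 0 and y = 1] that by simp_all
  have lim: "((\<lambda>t. \<integral>w. ((l i *\<^sub>R stacked (v i) 0) \<bullet> X t w)\<^sup>2 \<partial>\<Omega>) \<longlongrightarrow> \<gamma> / (2 * d) * (l i)\<^sup>2) at_top"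
    "((\<lambda>t. \<integral>w. (stacked 0 (v i) \<bullet> X t w)\<^sup>2 \<partial>\<Omega>) \<longlongrightarrow> \<gamma> / (2 * d) * (l i / m)) at_top" for i
    using mode(2)[OF eig root(2) norm_v, where x = "l i" and y = 0] mode(2)[OF eig root(2) norm_v, where x = 0 and y = 1] by simp_all
  have "((\<lambda>t. \<Sum>i\<in>UNIV. (\<integral>w. ((l i *\<^sub>R stacked (v i) 0) \<bullet> X t w)\<^sup>2 \<partial>\<Omega>) +
      (\<integral>w. (stacked 0 (v i) \<bullet> X t w)\<^sup>2 \<partial>\<Omega>)) \<longlongrightarrow>
      (\<Sum>i\<in>UNIV. \<gamma> / (2 * d) * (l i)\<^sup>2 + \<gamma> / (2 * d) * (l i / m))) at_top"
    by (intro tendsto_sum tendsto_add lim)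
  moreover have "\<forall>\<^sub>F t in at_top. (\<Sum>i\<in>UNIV. (\<integral>w. ((l i *\<^sub>R stacked (v i) 0) \<bullet> X t w)\<^sup>2 \<partial>\<Omega>) +
      (\<integral>w. (stacked 0 (v i) \<bullet> X t w)\<^sup>2 \<partial>\<Omega>)) = (\<integral>w. (C *v X t w) \<bullet> (C *v X t w) \<partial>\<Omega>)"
    using eventually_ge_at_top[of 0]
    by eventually_elim (simp only: out Bochner_Integration.integral_sum Bochner_Integration.integral_add int
        Bochner_Integration.integrable_add)
  ultimately have "((\<lambda>t. \<integral>w. (C *v X t w) \<bullet> (C *v X t w) \<partial>\<Omega>) \<longlongrightarrow>
      (\<Sum>i\<in>UNIV. \<gamma> / (2 * d) * (l i)\<^sup>2 + \<gamma> / (2 * d) * (l i / m))) at_top"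
    by (rule Lim_transform_eventually)
  also have "(\<Sum>i\<in>UNIV. \<gamma> / (2 * d) * (l i)\<^sup>2 + \<gamma> / (2 * d) * (l i / m))
      = \<gamma> / (2 * d) * (\<Sum>i\<in>UNIV. (l i)\<^sup>2 + l i / m)"
    by (simp only: sum_distrib_left distrib_left)
  also have "(\<Sum>i\<in>UNIV. (l i)\<^sup>2 + l i / m) = (\<Sum>i = 1..CARD('n). (eigval L i)\<^sup>2 + eigval L i / m)"
    using sum_eigval_orthonormal_eigenbasis[OF ortho eig, of "\<lambda>x. x\<^sup>2 + x / m"] by simp
  \<comment> \<open>The first summand vanishes with \<open>eigval L 1\<close>; for a single node the
    remaining sum is empty.\<close>
  also have "\<dots> = (\<Sum>i = 2..CARD('n). (eigval L i)\<^sup>2 + eigval L i / m)"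
    using \<open>eigval L 1 = 0\<close> by (subst sum.atLeast_Suc_atMost) (simp_all add: Suc_le_eq numeral_2_eq_2)
  finally have limit: "((\<lambda>t. \<integral>w. (C *v X t w) \<bullet> (C *v X t w) \<partial>\<Omega>) \<longlongrightarrow>
      \<gamma> / (2 * d) * (\<Sum>i = 2..CARD('n). (eigval L i)\<^sup>2 + eigval L i / m)) at_top" .
  have "integrable \<Omega> (\<lambda>w. (C *v X t w) \<bullet> (C *v X t w))" if "0 \<le> t" for t
    unfolding out by (intro Bochner_Integration.integrable_sum Bochner_Integration.integrable_add int that)
  with limit show ?thesis
    unfolding has_H2_norm_sq_def by blast
qed

end
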